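(* Let $T>0$, $d,m\ge1$, $\gamma\in(\tfrac12,1]$, $\lambda\in(\tfrac12,\gamma)$, and $x(0)\in\mathbb R^d$ with $x^i(0)>0$ for $i=1,\dots,d$. Let $\sigma:[0,T]\times\mathbb R^d\to\mathbb R^{d\times m}$ and $b:[0,T]\times\mathbb R^d\to\mathbb R^d$ be bounded, and suppose there are constants $K_0\ge 0$ and $\nu\ge\gamma$ such that for all $x,y\in\mathbb R^d$ and all $s,t\in[0,T]$: $$|\sigma(t,x)-\sigma(t,y)|\le K_0|x-y|,\qquad |\sigma(t,x)-\sigma(s,x)|\le K_0|t-s|^{\nu},\qquad |b(t,x)-b(t,y)|\le K_0|x-y|.$$ Then there exist positive constants $M_2$ and $M_3$ such that for every $g\in C^\gamma([0,T];\mathbb R^m)$ and every solution $x\in C^\lambda([0,T];\mathbb R^d)$ of $$x(t)=x(0)+\int_0^t b(s,x(s))\,ds+\int_0^t\sigma(s,x(s))\,dg_s+y(t),\qquad t\in(0,T],$$ where $$y^i(t)=\max_{s\in[0,t]}\big(z^i(s)\big)^-\ (i=1,\dots,d),\qquad z(t)=x(0)+\int_0^t b(s,x(s))\,ds+\int_0^t\sigma(s,x(s))\,dg_s,\qquad t\in[0,T],$$ it holds that $$\|x\|_{\lambda,[0,T]}\le M_2+M_3\,\|g\|_{\gamma,[0,T]}^{1/\gamma}$$ (so $M_2,M_3$ do not depend on $g$).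
   Context: For $0<\mu\le1$, $\|f\|_{\mu,[0,T]}:=\sup_{0\le u<v\le T}\frac{|f(v)-f(u)|}{(v-u)^\mu}$, and $C^\mu([0,T];V)$ is the space of $V$-valued functions $f$ on $[0,T]$ for which this is finite. For real $a$, $a^-=\max(-a,0)$. The integral with respect to $g$ is a Young integral, i.e. the limit of Riemann–Stieltjes sums as the mesh tends to zero, which exists when the integrand is $\lambda$-Hölder and the integrator is $\gamma$-Hölder with $\lambda+\gamma>1$. Being a solution includes that $s\mapsto b(s,x(s))$ is Lebesgue integrable on $[0,T]$ and that the value of $x$ at time $0$ is the given $x(0)$. *)

theory Defs
  imports "HOL-Analysis.Analysis"
begin

definition hoelder_quotients :: "real \<Rightarrow> real \<Rightarrow> (real \<Rightarrow> 'a::real_normed_vector) \<Rightarrow> real set" where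
  "hoelder_quotients \<mu> T f =
     {norm (f v - f u) / (v - u) powr \<mu> | u v. 0 \<le> u \<and> u < v \<and> v \<le> T}"

text \<open>The supremum is taken in the reals, so it is meaningful only for functions in
  \<open>hoelder_space \<mu> T\<close> (and \<open>T > 0\<close>).\<close>
definition hoelder_seminorm :: "real \<Rightarrow> real \<Rightarrow> (real \<Rightarrow> 'a::real_normed_vector) \<Rightarrow> real" where
  "hoelder_seminorm \<mu> T f = Sup (hoelder_quotients \<mu> T f)"

text \<open>Only the values of the function on \<open>[0,T]\<close> matter.\<close>
definition hoelder_space :: "real \<Rightarrow> real \<Rightarrow> (real \<Rightarrow> 'a::real_normed_vector) set" where
  "hoelder_space \<mu> T = {f. bdd_above (hoelder_quotients \<mu> T f)}"

text \<open>Limit of Riemann--Stieltjes sums, with arbitrary tags, as the mesh tends to zero (a uniform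
  mesh bound, not a gauge). Degenerate intervals \<open>{c}\<close> are allowed in tagged divisions but
  contribute zero.\<close>
definition has_young_integral ::
    "(real \<Rightarrow> real^'m^'d) \<Rightarrow> (real \<Rightarrow> real^'m) \<Rightarrow> real \<Rightarrow> real \<Rightarrow> real^'d \<Rightarrow> bool" where
  "has_young_integral f g a b I \<longleftrightarrow>
     (\<forall>\<epsilon>>0. \<exists>\<delta>>0. \<forall>p. p tagged_division_of {a..b} \<and> (\<forall>(\<xi>, k)\<in>p. Sup k - Inf k < \<delta>) \<longrightarrow>
        norm ((\<Sum>(\<xi>, k)\<in>p. f \<xi> *v (g (Sup k) - g (Inf k))) - I) < \<epsilon>)"

definition young_integral ::
    "(real \<Rightarrow> real^'m^'d) \<Rightarrow> (real \<Rightarrow> real^'m) \<Rightarrow> real \<Rightarrow> real \<Rightarrow> real^'d" where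
  "young_integral f g a b = (THE I. has_young_integral f g a b I)"

definition unreflected_path ::
    "(real \<Rightarrow> real^'d \<Rightarrow> real^'d) \<Rightarrow> (real \<Rightarrow> real^'d \<Rightarrow> real^'m^'d) \<Rightarrow> (real \<Rightarrow> real^'m) \<Rightarrow>
      real^'d \<Rightarrow> (real \<Rightarrow> real^'d) \<Rightarrow> real \<Rightarrow> real^'d" where
  "unreflected_path b \<sigma> g x0 x t =
     x0 + (LINT s:{0..t}|lebesgue. b s (x s)) + young_integral (\<lambda>s. \<sigma> s (x s)) g 0 t"

text \<open>The maximum is rendered as a supremum (\<open>Max\<close> is meant for finite sets); the two agree
  for continuous \<open>z\<close>.\<close>
definition regulator :: "(real \<Rightarrow> real^'d) \<Rightarrow> real \<Rightarrow> real^'d" where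
  "regulator z t = (\<chi> i. SUP s\<in>{0..t}. max (- (z s $ i)) 0)"

definition is_reflected_solution ::
    "real \<Rightarrow> (real \<Rightarrow> real^'d \<Rightarrow> real^'d) \<Rightarrow> (real \<Rightarrow> real^'d \<Rightarrow> real^'m^'d) \<Rightarrow> (real \<Rightarrow> real^'m) \<Rightarrow>
      real^'d \<Rightarrow> (real \<Rightarrow> real^'d) \<Rightarrow> bool" where
  "is_reflected_solution T b \<sigma> g x0 x \<longleftrightarrow>
     set_integrable lebesgue {0..T} (\<lambda>s. b s (x s)) \<and>
     x 0 = x0 \<and>
     (\<forall>t\<in>{0<..T}. x t = unreflected_path b \<sigma> g x0 x t + regulator (unreflected_path b \<sigma> g x0 x) t)"

end

theory Submission
  imports Defs
begin

text \<open>The Young integral is obtained from left-point sums along dyadic grids. Passing from one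
  level to the next changes an increment over \<open>[s,t]\<close> by at most a constant for each grid cell
  that meets \<open>[s,t]\<close>, and these changes are summable because the exponents add up to more than 1.
  The limit \<open>J\<close> satisfies the Young--Loeve estimate on every subinterval; summed over the
  intervals of a tagged division, this estimate shows that arbitrary Riemann--Stieltjes sums
  converge to the increments of \<open>J\<close>.

  For a solution, reflection enlarges increments by at most a dimensional factor. So if
  \<open>N\<close> is the local Hoelder constant of \<open>x\<close> on intervals of length at most \<open>\<Delta>\<close>, the Young--Loeve
  estimate yields \<open>N \<le> A + c G \<Delta>\<^sup>\<gamma> N\<close> with \<open>G\<close> the seminorm of \<open>g\<close>. Choosing \<open>\<Delta>\<close> of order
  \<open>min T (G powr (- 1 / \<gamma>))\<close> absorbs the last term, and chaining about \<open>T / \<Delta>\<close> intervals gives the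
  power \<open>1 / \<gamma>\<close>.\<close>

section \<open>The Young integral of Hoelder functions\<close>

text \<open>The norm of \<open>real^'m^'d\<close> is the Frobenius norm, so Cauchy--Schwarz in each
  row suffices.\<close>

lemma norm_matrix_vector_mult_le:
  fixes A :: "real^'m^'d"
  shows "norm (A *v x) \<le> norm A * norm x"
proof -
  have "norm (A *v x) = L2_set (\<lambda>i. norm ((A *v x) $ i)) UNIV"
    by (simp add: norm_vec_def)
  also have "\<dots> \<le> L2_set (\<lambda>i. norm (A $ i) * norm x) UNIV"
    by (intro L2_set_mono) (auto simp: matrix_vector_mul_component Cauchy_Schwarz_ineq2)
  also have "\<dots> = norm A * norm x"
    by (simp add: norm_vec_def[of A] L2_set_left_distrib)
  finally show ?thesis .
qed

section \<open>Chaining over grid cells and telescoping over levels\<close>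

text \<open>The grid points between \<open>s\<close> and \<open>t\<close> split the increment into
  at most \<open>(t - s) / \<delta> + 2\<close> pieces, each inside one cell. It serves twice: for
  comparing two grids, and for turning a bound at short range into a global one.\<close>

lemma norm_diff_le_of_cells:
  fixes F :: "real \<Rightarrow> 'a::real_normed_vector"
  assumes "\<delta> > 0" "0 \<le> s" "s \<le> t" "0 \<le> c"
    and cell: "\<And>k u v. \<lbrakk>s \<le> u; u \<le> v; v \<le> t; real k * \<delta> \<le> u; v \<le> real (Suc k) * \<delta>\<rbrakk>
      \<Longrightarrow> norm (F v - F u) \<le> c"
  shows "norm (F t - F s) \<le> c * ((t - s) / \<delta> + 2)"
proof -
  define k where "k = nat \<lfloor>s / \<delta>\<rfloor>"
  have k: "real k \<le> s / \<delta>" "s / \<delta> < real k + 1"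
    using assms by (auto simp: k_def)
  have kd: "real k * \<delta> \<le> s" "s \<le> real (Suc k) * \<delta>"
    using k \<open>\<delta> > 0\<close> by (auto simp: field_simps)
  have ind: "norm (F r - F s) \<le> c * (real n + 1)"
    if "s \<le> r" "r \<le> t" "r \<le> real (k + 1 + n) * \<delta>" for n r
    using that
  proof (induction n arbitrary: r)
    case 0
    then show ?case using cell[of s r k] kd by simp
  next
    case (Suc n)
    show ?case
    proof (cases "r \<le> real (k + 1 + n) * \<delta>")
      case True
      then have "norm (F r - F s) \<le> c * (real n + 1)" using Suc by blast
      also have "\<dots> \<le> c * (real (Suc n) + 1)" using \<open>0 \<le> c\<close> by (intro mult_left_mono) auto
      finally show ?thesis .
    next
      case False
      define w where "w = real (k + 1 + n) * \<delta>"
      have "real (Suc k) * \<delta> \<le> w"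
        using \<open>\<delta> > 0\<close> unfolding w_def by (intro mult_right_mono) auto
      then have w: "s \<le> w" "w \<le> r" using kd False by (auto simp: w_def)
      have "norm (F w - F s) \<le> c * (real n + 1)"
        using Suc.IH[of w] w Suc.prems by (auto simp: w_def)
      moreover have "norm (F r - F w) \<le> c"
        using cell[of w r "k + 1 + n"] w Suc.prems by (auto simp: w_def)
      moreover have "norm (F r - F s) \<le> norm (F r - F w) + norm (F w - F s)"
        by norm
      ultimately show ?thesis by (simp add: algebra_simps)
    qed
  qed
  \<comment> \<open>Counts the cells entered after the one containing \<open>s\<close>. When
    \<open>t\<close> lies in that same cell, \<open>nat\<close> truncates to 0, hence the maximum
    with 0 below.\<close>
  define n where "n = nat \<lceil>t / \<delta> - k - 1\<rceil>"
  have "t / \<delta> - k - 1 \<le> real n" unfolding n_def by (rule real_nat_ceiling_ge)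
  then have "t \<le> real (k + 1 + n) * \<delta>" using \<open>\<delta> > 0\<close> by (simp add: field_simps)
  then have 1: "norm (F t - F s) \<le> c * (real n + 1)" using ind assms by blast
  have "s / \<delta> \<le> t / \<delta>" using assms by (simp add: divide_right_mono)
  then have "real n \<le> max 0 (t / \<delta> - k)" unfolding n_def by linarith
  also have "\<dots> \<le> (t - s) / \<delta> + 1" using k \<open>s / \<delta> \<le> t / \<delta>\<close> by (simp add: diff_divide_distrib)
  finally have "c * (real n + 1) \<le> c * ((t - s) / \<delta> + 2)"
    using \<open>0 \<le> c\<close> by (intro mult_left_mono) auto
  then show ?thesis using 1 by linarith
qed

text \<open>Telescoping and comparison with the geometric series; \<open>a\<close> will be the
  increment, over a fixed interval, of the sums at successive dyadic levels.\<close>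

lemma geometric_increments:
  fixes a :: "nat \<Rightarrow> 'a::banach"
  assumes inc: "\<And>n. norm (a (Suc n) - a n) \<le> c * q ^ n" and q: "0 \<le> q" "q < 1"
  shows "convergent a" and "a \<longlonglongrightarrow> l \<Longrightarrow> norm (l - a 0) \<le> c / (1 - q)"
proof -
  have c: "(\<lambda>n. c * q ^ n) sums (c * (1 / (1 - q)))"
    using q by (intro sums_mult geometric_sums) auto
  have "summable (\<lambda>n. a (Suc n) - a n)"
    using c inc by (meson summable_comparison_test' sums_summable)
  then have "convergent (\<lambda>n. a n - a 0)"
    by (simp add: summable_iff_convergent sum_lessThan_telescope)
  then show "convergent a"
    by (simp add: convergent_diff_const_right_iff)
  assume l: "a \<longlonglongrightarrow> l"
  have "norm (a m - a 0) \<le> c / (1 - q)" for m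
  proof -
    have "norm (a m - a 0) = norm (\<Sum>n<m. a (Suc n) - a n)"
      by (simp add: sum_lessThan_telescope)
    also have "\<dots> \<le> (\<Sum>n<m. c * q ^ n)"
      by (intro order_trans[OF norm_sum] sum_mono inc)
    \<comment> \<open>The terms \<open>c * q ^ n\<close> are nonnegative because by
      \<open>inc\<close> they dominate norms.\<close>
    also have "\<dots> \<le> (\<Sum>n. c * q ^ n)"
      using c inc by (intro sum_le_suminf) (auto simp: sums_iff intro: order_trans[OF norm_ge_zero])
    finally show ?thesis using c by (simp add: sums_iff)
  qed
  moreover have "(\<lambda>m. norm (a m - a 0)) \<longlonglongrightarrow> norm (l - a 0)"
    by (intro tendsto_intros l)
  ultimately show "norm (l - a 0) \<le> c / (1 - q)"
    by (intro LIMSEQ_le_const2) auto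
qed

section \<open>Left-point sums along uniform grids\<close>

text \<open>The last cell is cut off at \<open>t\<close>, so that the increment within one cell is
  exactly the integrand at the left end of the cell applied to the increment of \<open>g\<close>.
  The grid is anchored at 0 for every \<open>t\<close>, which makes increments additive.\<close>

definition left_sum ::
    "(real \<Rightarrow> real^'m^'d) \<Rightarrow> (real \<Rightarrow> real^'m) \<Rightarrow> real \<Rightarrow> real \<Rightarrow> real^'d" where
  "left_sum f g \<delta> t =
     (\<Sum>k<nat \<lfloor>t / \<delta>\<rfloor>. f (real k * \<delta>) *v (g (real (Suc k) * \<delta>) - g (real k * \<delta>))) +
     f (real (nat \<lfloor>t / \<delta>\<rfloor>) * \<delta>) *v (g t - g (real (nat \<lfloor>t / \<delta>\<rfloor>) * \<delta>))"

text \<open>At the right end of a cell the floor already selects the next cell, but the extra term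
  vanishes there; hence the formula holds on closed cells and adjacent cells agree at their common
  point.\<close>

lemma left_sum_in_cell:
  assumes "\<delta> > 0" "real k * \<delta> \<le> t" "t \<le> real (Suc k) * \<delta>"
  shows "left_sum f g \<delta> t =
    (\<Sum>j<k. f (real j * \<delta>) *v (g (real (Suc j) * \<delta>) - g (real j * \<delta>))) +
    f (real k * \<delta>) *v (g t - g (real k * \<delta>))"
proof (cases "t = real (Suc k) * \<delta>")
  case True
  have "nat \<lfloor>t / \<delta>\<rfloor> = Suc k"
    using \<open>\<delta> > 0\<close> unfolding True by (simp add: nat_eq_iff)
  then show ?thesis
    unfolding left_sum_def using True by (simp add: matrix_vector_mult_diff_distrib)
next
  case False
  have "\<lfloor>t / \<delta>\<rfloor> = int k"
    using assms False by (intro floor_unique) (auto simp: field_simps)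
  then show ?thesis
    by (simp add: left_sum_def)
qed

lemma left_sum_diff_in_cell:
  assumes "\<delta> > 0" "real k * \<delta> \<le> s" "s \<le> t" "t \<le> real (Suc k) * \<delta>"
  shows "left_sum f g \<delta> t - left_sum f g \<delta> s = f (real k * \<delta>) *v (g t - g s)"
  using left_sum_in_cell[of \<delta> k t f g] left_sum_in_cell[of \<delta> k s f g] assms
  by (simp add: matrix_vector_mult_diff_distrib)

lemma left_sum_0 [simp]: "left_sum f g \<delta> 0 = 0"
  by (simp add: left_sum_def)

text \<open>Inside a cell of the finer grid the two sums differ only in the point where
  \<open>f\<close> is frozen, which costs \<open>L * G * \<delta> powr (\<alpha> + \<beta>)\<close>.
  Multiplying by the number of cells loses one power of \<open>\<delta>\<close>; what remains is
  summable over dyadic levels when \<open>\<alpha> + \<beta> > 1\<close>.\<close>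

lemma left_sum_halving:
  fixes f :: "real \<Rightarrow> real^'m^'d"
  assumes "\<delta> > 0" "0 \<le> s" "s \<le> t" "L \<ge> 0" "G \<ge> 0" "\<alpha> > 0" "\<beta> > 0"
    and f: "\<And>u v. norm (f v - f u) \<le> L * \<bar>v - u\<bar> powr \<alpha>"
    and g: "\<And>u v. norm (g v - g u) \<le> G * \<bar>v - u\<bar> powr \<beta>"
  shows "norm ((left_sum f g (\<delta> / 2) t - left_sum f g (\<delta> / 2) s) - (left_sum f g \<delta> t - left_sum f g \<delta> s))
    \<le> 2 * (L * G) * \<delta> powr (\<alpha> + \<beta> - 1) * (t - s + \<delta>)"
proof -
  define F where "F t = left_sum f g (\<delta> / 2) t - left_sum f g \<delta> t" for t
  have "norm (F t - F s) \<le> (L * G * \<delta> powr (\<alpha> + \<beta>)) * ((t - s) / (\<delta> / 2) + 2)"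
  proof (rule norm_diff_le_of_cells)
    fix k u v
    assume uv: "s \<le> u" "u \<le> v" "v \<le> t" "real k * (\<delta> / 2) \<le> u" "v \<le> real (Suc k) * (\<delta> / 2)"
    \<comment> \<open>The coarse cell containing the \<open>k\<close>-th fine cell; their left ends
      differ by 0 or \<open>\<delta> / 2\<close>.\<close>
    define j where "j = k div 2"
    have jk: "2 * j \<le> k" "k \<le> 2 * j + 1" by (auto simp: j_def)
    have jk': "2 * real j \<le> real k" "real k \<le> 2 * real j + 1" using jk by linarith+
    have "2 * real j * (\<delta> / 2) \<le> real k * (\<delta> / 2)" "real k * (\<delta> / 2) \<le> (2 * real j + 1) * (\<delta> / 2)"
      using jk' \<open>\<delta> > 0\<close> by (intro mult_right_mono; simp)+
    then have d: "real j * \<delta> \<le> real k * (\<delta> / 2)" "real k * (\<delta> / 2) \<le> real j * \<delta> + \<delta> / 2"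
      by (auto simp: field_simps)
    have e: "real (Suc k) * (\<delta> / 2) = real k * (\<delta> / 2) + \<delta> / 2" "real (Suc j) * \<delta> = real j * \<delta> + \<delta>"
      by (auto simp: field_simps)
    have uj: "real j * \<delta> \<le> u" "v \<le> real (Suc j) * \<delta>" "v - u \<le> \<delta>"
      using uv d e \<open>\<delta> > 0\<close> by linarith+
    have eq: "F v - F u = (f (real k * (\<delta> / 2)) - f (real j * \<delta>)) *v (g v - g u)"
    proof -
      have "left_sum f g (\<delta> / 2) v - left_sum f g (\<delta> / 2) u = f (real k * (\<delta> / 2)) *v (g v - g u)"
        using uv \<open>\<delta> > 0\<close> by (intro left_sum_diff_in_cell) auto
      moreover have "left_sum f g \<delta> v - left_sum f g \<delta> u = f (real j * \<delta>) *v (g v - g u)"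
        using uv uj \<open>\<delta> > 0\<close> by (intro left_sum_diff_in_cell) auto
      ultimately show ?thesis
        by (simp add: F_def matrix_vector_mult_diff_rdistrib algebra_simps)
    qed
    have "norm (f (real k * (\<delta> / 2)) - f (real j * \<delta>)) \<le> L * \<delta> powr \<alpha>"
      using d \<open>\<delta> > 0\<close> \<open>L \<ge> 0\<close> \<open>\<alpha> > 0\<close>
      by (intro order_trans[OF f] mult_left_mono powr_mono2) auto
    moreover have "norm (g v - g u) \<le> G * \<delta> powr \<beta>"
      using uv uj \<open>\<delta> > 0\<close> \<open>G \<ge> 0\<close> \<open>\<beta> > 0\<close>
      by (intro order_trans[OF g] mult_left_mono powr_mono2) auto
    ultimately have "norm (F v - F u) \<le> (L * \<delta> powr \<alpha>) * (G * \<delta> powr \<beta>)"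
      unfolding eq using \<open>L \<ge> 0\<close>
      by (intro order_trans[OF norm_matrix_vector_mult_le] mult_mono) auto
    then show "norm (F v - F u) \<le> L * G * \<delta> powr (\<alpha> + \<beta>)"
      by (simp add: powr_add algebra_simps)
  qed (use assms in auto)
  also have "\<dots> = 2 * (L * G) * \<delta> powr (\<alpha> + \<beta> - 1) * (t - s + \<delta>)"
    using \<open>\<delta> > 0\<close> by (simp add: powr_diff field_simps)
  finally show ?thesis
    by (simp add: F_def algebra_simps)
qed

text \<open>An interval of length at most \<open>\<delta>\<close> is covered by two consecutive
  cells, and in each of them \<open>f\<close> is frozen at a point within \<open>\<delta>\<close> of
  \<open>s\<close>. The factor 2 counts the two cells.\<close>

lemma left_sum_germ:
  fixes f :: "real \<Rightarrow> real^'m^'d"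
  assumes "\<delta> > 0" "0 \<le> s" "s \<le> t" "t - s \<le> \<delta>" "L \<ge> 0" "G \<ge> 0" "\<alpha> > 0" "\<beta> > 0"
    and f: "\<And>u v. norm (f v - f u) \<le> L * \<bar>v - u\<bar> powr \<alpha>"
    and g: "\<And>u v. norm (g v - g u) \<le> G * \<bar>v - u\<bar> powr \<beta>"
  shows "norm (left_sum f g \<delta> t - left_sum f g \<delta> s - f s *v (g t - g s)) \<le> 2 * (L * G) * \<delta> powr (\<alpha> + \<beta>)"
proof -
  define k where "k = nat \<lfloor>s / \<delta>\<rfloor>"
  have "real k \<le> s / \<delta>" "s / \<delta> < real k + 1"
    using assms by (auto simp: k_def)
  then have k: "real k * \<delta> \<le> s" "s \<le> real (Suc k) * \<delta>"
    using \<open>\<delta> > 0\<close> by (auto simp: field_simps)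
  define p where "p = real k * \<delta>"
  have e: "real (Suc k) * \<delta> = p + \<delta>" "real (Suc (Suc k)) * \<delta> = p + \<delta> + \<delta>"
    by (auto simp: p_def algebra_simps)
  have p: "p \<le> s" "s \<le> p + \<delta>" using k e(1) by (simp_all add: p_def)
  then have near: "\<bar>real k * \<delta> - s\<bar> \<le> \<delta>" "\<bar>t - s\<bar> \<le> \<delta>" using assms by (simp_all flip: p_def)
  have bound: "norm ((f p - f q) *v (g v - g u)) \<le> L * G * \<delta> powr (\<alpha> + \<beta>)"
    if "\<bar>p - q\<bar> \<le> \<delta>" "\<bar>v - u\<bar> \<le> \<delta>" for p q u v
  proof -
    have "norm (f p - f q) \<le> L * \<delta> powr \<alpha>" "norm (g v - g u) \<le> G * \<delta> powr \<beta>"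
      using that assms by (auto intro!: order_trans[OF f] order_trans[OF g] mult_left_mono powr_mono2)
    then have "norm ((f p - f q) *v (g v - g u)) \<le> (L * \<delta> powr \<alpha>) * (G * \<delta> powr \<beta>)"
      using \<open>L \<ge> 0\<close> by (intro order_trans[OF norm_matrix_vector_mult_le] mult_mono) auto
    then show ?thesis
      by (simp add: powr_add algebra_simps)
  qed
  have LG: "0 \<le> L * G * \<delta> powr (\<alpha> + \<beta>)" using assms by simp
  show ?thesis
  proof (cases "t \<le> real (Suc k) * \<delta>")
    case True
    have "left_sum f g \<delta> t - left_sum f g \<delta> s = f (real k * \<delta>) *v (g t - g s)"
      using k assms True by (intro left_sum_diff_in_cell) auto
    then have eq: "left_sum f g \<delta> t - left_sum f g \<delta> s - f s *v (g t - g s) = (f (real k * \<delta>) - f s) *v (g t - g s)"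
      by (simp add: matrix_vector_mult_diff_rdistrib)
    have "norm ((f (real k * \<delta>) - f s) *v (g t - g s)) \<le> L * G * \<delta> powr (\<alpha> + \<beta>)"
      by (intro bound near)
    then show ?thesis unfolding eq using LG by linarith
  next
    case False
    define c where "c = real (Suc k) * \<delta>"
    have c: "s \<le> c" "c \<le> t" "real k * \<delta> \<le> c" "t \<le> real (Suc (Suc k)) * \<delta>"
      using p assms(1-4) False unfolding c_def p_def[symmetric] e by auto
    then have near': "\<bar>c - s\<bar> \<le> \<delta>" "\<bar>t - c\<bar> \<le> \<delta>"
      using p assms(1-4) unfolding c_def e by auto
    have h1: "left_sum f g \<delta> c - left_sum f g \<delta> s = f (real k * \<delta>) *v (g c - g s)"
      using k c \<open>\<delta> > 0\<close> by (intro left_sum_diff_in_cell) (auto simp: c_def)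
    have h2: "left_sum f g \<delta> t - left_sum f g \<delta> c = f c *v (g t - g c)"
      using c \<open>\<delta> > 0\<close> unfolding c_def by (intro left_sum_diff_in_cell) auto
    have eq: "left_sum f g \<delta> t - left_sum f g \<delta> s - f s *v (g t - g s) =
        (f (real k * \<delta>) - f s) *v (g c - g s) + (f c - f s) *v (g t - g c)"
      proof -
      have "left_sum f g \<delta> t - left_sum f g \<delta> s =
          (left_sum f g \<delta> c - left_sum f g \<delta> s) + (left_sum f g \<delta> t - left_sum f g \<delta> c)"
        by simp
      then show ?thesis
        unfolding h1 h2 by (simp add: matrix_vector_mult_diff_rdistrib matrix_vector_mult_diff_distrib)
    qed
    have "norm ((f (real k * \<delta>) - f s) *v (g c - g s)) \<le> L * G * \<delta> powr (\<alpha> + \<beta>)"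
      by (intro bound near near')
    moreover have "norm ((f c - f s) *v (g t - g c)) \<le> L * G * \<delta> powr (\<alpha> + \<beta>)"
      by (intro bound near near')
    ultimately show ?thesis
      unfolding eq by (intro order_trans[OF norm_triangle_ineq]) linarith
  qed
qed

text \<open>The two summands are the error of the finest grid with cells at least as long as \<open>t - s\<close> and
  the sum of the geometric series of all refinements.\<close>

definition young_const :: "real \<Rightarrow> real" where
  "young_const \<theta> = 2 * 2 powr \<theta> + 6 * 2 powr (\<theta> - 1) / (1 - 2 powr (1 - \<theta>))"

lemma young_const_nonneg: "\<theta> > 1 \<Longrightarrow> young_const \<theta> \<ge> 0"
  using powr_less_mono[of "1 - \<theta>" 0 "2::real"] by (simp add: young_const_def)

section \<open>The dyadic limit and the Young--Loeve estimate\<close>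

text \<open>Take the last dyadic level with cells at least as long as \<open>h\<close>; cells of the
  next level are shorter than \<open>h\<close>, which gives the factor 2.\<close>

lemma ex_dyadic_scale:
  assumes "0 < h" "h \<le> (D::real)"
  obtains n :: nat where "D / 2 ^ n < 2 * h" "h \<le> D / 2 ^ n"
proof -
  have "D > 0" using assms by linarith
  obtain m where "(1 / 2) ^ m < h / D"
    using real_arch_pow_inv[of "h / D" "1 / 2"] \<open>0 < h\<close> \<open>D > 0\<close> by auto
  then have "D / 2 ^ m < h"
    using \<open>D > 0\<close> by (simp add: field_simps)
  then obtain n where "\<not> D / 2 ^ n < h" "D / 2 ^ (n + 1) < h"
    using ex_least_nat_less[of "\<lambda>n. D / 2 ^ n < h" m] assms by auto
  then show ?thesis
    by (intro that[of n]) auto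
qed

text \<open>The dyadic sums converge to one path \<open>J\<close> for all intervals. For given
  \<open>s\<close> and \<open>t\<close>, the level with cells comparable to \<open>t - s\<close> is
  close to \<open>f s *v (g t - g s)\<close> by \<open>left_sum_germ\<close>, and the finer levels
  add a geometric series by \<open>left_sum_halving\<close>.\<close>

lemma sewing:
  fixes f :: "real \<Rightarrow> real^'m^'d" and g :: "real \<Rightarrow> real^'m"
  assumes "D > 0" "L \<ge> 0" "G \<ge> 0" "\<alpha> > 0" "\<beta> > 0" and \<theta>: "\<alpha> + \<beta> > 1"
    and f: "\<And>u v. norm (f v - f u) \<le> L * \<bar>v - u\<bar> powr \<alpha>"
    and g: "\<And>u v. norm (g v - g u) \<le> G * \<bar>v - u\<bar> powr \<beta>"
  shows "\<exists>J. \<forall>s t. 0 \<le> s \<and> s \<le> t \<and> t - s \<le> D \<longrightarrow>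
    norm (J t - J s - f s *v (g t - g s)) \<le> young_const (\<alpha> + \<beta>) * (L * G * (t - s) powr (\<alpha> + \<beta>))"
proof -
  define \<theta> where "\<theta> = \<alpha> + \<beta>"
  define K where "K = L * G"
  have K: "K \<ge> 0" using assms by (simp add: K_def)
  \<comment> \<open>The factor by which \<open>\<delta> powr (\<theta> - 1)\<close> shrinks when the
    mesh \<open>\<delta>\<close> is halved.\<close>
  define q :: real where "q = 2 powr (1 - \<theta>)"
  have q: "0 \<le> q" "q < 1" using \<theta> powr_less_mono[of "1 - \<theta>" 0 "2::real"] by (auto simp: q_def \<theta>_def)
  define e where "e n = D / 2 ^ n" for n :: nat
  have e: "e n > 0" "e (Suc n) = e n / 2" for n using \<open>D > 0\<close> by (auto simp: e_def)
  have e_pow: "e (n + m) powr (\<theta> - 1) = e n powr (\<theta> - 1) * q ^ m" for n m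
  proof -
    have "(2 ^ m) powr (1 - \<theta>) = q ^ m"
    proof -
      have "(2 ^ m) powr (1 - \<theta>) = (2 powr real m) powr (1 - \<theta>)"
        by (subst powr_realpow) auto
      also have "\<dots> = q powr real m"
        unfolding q_def by (rule powr_powr_swap)
      also have "\<dots> = q ^ m"
        by (rule powr_realpow) (simp add: q_def)
      finally show ?thesis .
    qed
    moreover have "e (n + m) powr (\<theta> - 1) = e n powr (\<theta> - 1) * (2 ^ m) powr (1 - \<theta>)"
    proof -
      have "e (n + m) = e n * (1 / 2 ^ m)" by (simp add: e_def power_add)
      then have "e (n + m) powr (\<theta> - 1) = e n powr (\<theta> - 1) * (1 / 2 ^ m) powr (\<theta> - 1)"
        using e(1)[of n] by (simp only: powr_mult less_imp_le)
      also have "(1 / 2 ^ m) powr (\<theta> - 1) = (2 ^ m :: real) powr (1 - \<theta>)"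
        by (simp add: powr_divide powr_diff)
      finally show ?thesis .
    qed
    ultimately show ?thesis by simp
  qed
  have e_mono: "e (n + m) \<le> e n" for n m
    using \<open>D > 0\<close> by (auto simp: e_def intro!: divide_left_mono power_increasing)
  define S where "S n t = left_sum f g (e n) t" for n t
  have step: "norm ((S (Suc (n + m)) t - S (Suc (n + m)) s) - (S (n + m) t - S (n + m) s))
      \<le> (2 * K * e n powr (\<theta> - 1) * (t - s + e n)) * q ^ m"
    if "0 \<le> s" "s \<le> t" for n m s t
  proof -
    have "norm ((S (Suc (n + m)) t - S (Suc (n + m)) s) - (S (n + m) t - S (n + m) s))
        \<le> 2 * K * e (n + m) powr (\<theta> - 1) * (t - s + e (n + m))"
      unfolding S_def e(2) K_def \<theta>_def using assms that e(1) by (intro left_sum_halving)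
    also have "\<dots> \<le> 2 * K * e (n + m) powr (\<theta> - 1) * (t - s + e n)"
      using K e_mono[of n m] by (intro mult_left_mono) auto
    finally show ?thesis by (simp add: e_pow mult_ac)
  qed
  define J where "J t = lim (\<lambda>n. S n t)" for t
  have J: "(\<lambda>n. S n t) \<longlonglongrightarrow> J t" if "0 \<le> t" for t
  proof -
    have "norm (S (Suc n) t - S n t) \<le> (2 * K * e 0 powr (\<theta> - 1) * (t + e 0)) * q ^ n" for n
      using step[of 0 t 0 n] that by (simp add: S_def)
    then have "convergent (\<lambda>n. S n t)"
      by (intro geometric_increments(1)[OF _ q])
    then show ?thesis
      by (simp add: J_def convergent_LIMSEQ_iff)
  qed
  have "norm (J t - J s - f s *v (g t - g s)) \<le> young_const \<theta> * (K * (t - s) powr \<theta>)"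
    if st: "0 \<le> s" "s \<le> t" "t - s \<le> D" for s t
  proof (cases "s = t")
    case False
    define h where "h = t - s"
    have h: "0 < h" "h \<le> D" using st False by (auto simp: h_def)
    obtain n where n: "e n < 2 * h" "h \<le> e n"
      using ex_dyadic_scale[OF h] unfolding e_def by blast
    have pow1: "e n powr \<theta> \<le> 2 powr \<theta> * h powr \<theta>"
      using n e(1)[of n] h \<theta> powr_mono2[of \<theta> "e n" "2 * h"] by (simp add: powr_mult \<theta>_def)
    have pow2: "e n powr (\<theta> - 1) \<le> 2 powr (\<theta> - 1) * h powr (\<theta> - 1)"
      using n e(1)[of n] h \<theta> powr_mono2[of "\<theta> - 1" "e n" "2 * h"] by (simp add: powr_mult \<theta>_def)
    have hp: "h powr (\<theta> - 1) * h = h powr \<theta>"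
      using h by (simp add: powr_diff)
    have "norm (S n t - S n s - f s *v (g t - g s)) \<le> 2 * K * e n powr \<theta>"
      unfolding S_def K_def \<theta>_def using assms st n e(1) by (intro left_sum_germ) (auto simp: h_def)
    also have "\<dots> \<le> 2 * K * (2 powr \<theta> * h powr \<theta>)"
      using K pow1 by (intro mult_left_mono) auto
    finally have A: "norm (S n t - S n s - f s *v (g t - g s)) \<le> 2 * K * (2 powr \<theta> * h powr \<theta>)" .
    \<comment> \<open>Starting the telescoping at level \<open>n\<close>, the scale of
      \<open>t - s\<close>, instead of at \<open>D\<close> is what yields the power
      \<open>(t - s) powr \<theta>\<close>.\<close>
    have "(\<lambda>m. S (n + m) t - S (n + m) s) \<longlonglongrightarrow> J t - J s"
      using st by (intro tendsto_diff LIMSEQ_ignore_initial_segment[OF J, of _ n, unfolded add.commute[of _ n]]) auto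
    then have "norm ((J t - J s) - (S (n + 0) t - S (n + 0) s))
        \<le> (2 * K * e n powr (\<theta> - 1) * (t - s + e n)) / (1 - q)"
      using step[OF st(1,2), of n] q by (intro geometric_increments(2)) auto
    \<comment> \<open>Here \<open>t - s + e n \<le> 3 * h\<close>; with the factor 2 this is the 6
      in \<open>young_const\<close>.\<close>
    also have "\<dots> \<le> (2 * K * (2 powr (\<theta> - 1) * h powr (\<theta> - 1)) * (3 * h)) / (1 - q)"
      using K q n h pow2 by (intro divide_right_mono mult_mono) (auto simp: h_def)
    also have "\<dots> = 6 * 2 powr (\<theta> - 1) / (1 - q) * (K * (h powr (\<theta> - 1) * h))"
      by (simp add: field_simps)
    finally have B: "norm ((J t - J s) - (S n t - S n s)) \<le> 6 * 2 powr (\<theta> - 1) / (1 - q) * (K * h powr \<theta>)"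
      by (simp add: hp)
    have "norm (J t - J s - f s *v (g t - g s))
        \<le> norm ((J t - J s) - (S n t - S n s)) + norm (S n t - S n s - f s *v (g t - g s))"
      by norm
    also have "\<dots> \<le> young_const \<theta> * (K * h powr \<theta>)"
      using A B unfolding young_const_def q_def by (simp add: algebra_simps)
    finally show ?thesis by (simp add: h_def)
  qed simp
  then show ?thesis unfolding K_def \<theta>_def by blast
qed

lemma young_loeve:
  fixes f :: "real \<Rightarrow> real^'m^'d" and g :: "real \<Rightarrow> real^'m"
  assumes "a < b" "L \<ge> 0" "G \<ge> 0" "\<alpha> > 0" "\<beta> > 0" "\<alpha> + \<beta> > 1"
    and f: "\<And>u v. \<lbrakk>a \<le> u; u \<le> v; v \<le> b\<rbrakk> \<Longrightarrow> norm (f v - f u) \<le> L * (v - u) powr \<alpha>"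
    and g: "\<And>u v. \<lbrakk>a \<le> u; u \<le> v; v \<le> b\<rbrakk> \<Longrightarrow> norm (g v - g u) \<le> G * (v - u) powr \<beta>"
  shows "\<exists>J. \<forall>s t. a \<le> s \<and> s \<le> t \<and> t \<le> b \<longrightarrow>
    norm (J t - J s - f s *v (g t - g s)) \<le> young_const (\<alpha> + \<beta>) * (L * G * (t - s) powr (\<alpha> + \<beta>))"
proof -
  \<comment> \<open>Clipping to \<open>[a,b]\<close>, since grid cells may stick out of the interval.\<close>
  define c where "c u = max a (min b (a + u))" for u
  have c: "a \<le> c u" "c u \<le> b" "\<bar>c v - c u\<bar> \<le> \<bar>v - u\<bar>" for u v
    using \<open>a < b\<close> by (auto simp: c_def)
  \<comment> \<open>Clipping is 1-Lipschitz, so Hoelder constants survive. The target space is left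
    arbitrary because both the matrices \<open>f\<close> and the vectors \<open>g\<close> are
    clipped.\<close>
  have clip: "norm (F (c v) - F (c u)) \<le> M * \<bar>v - u\<bar> powr \<mu>"
    if F: "\<And>u v. \<lbrakk>a \<le> u; u \<le> v; v \<le> b\<rbrakk> \<Longrightarrow> norm (F v - F u) \<le> M * (v - u) powr \<mu>" and "M \<ge> 0" "\<mu> > 0"
    for F :: "real \<Rightarrow> 'z::real_normed_vector" and M \<mu> u v
  proof -
    have "norm (F (c v) - F (c u)) \<le> M * \<bar>c v - c u\<bar> powr \<mu>"
      using F[of "c u" "c v"] F[of "c v" "c u"] c
      by (cases "c u \<le> c v") (auto simp: norm_minus_commute)
    also have "\<dots> \<le> M * \<bar>v - u\<bar> powr \<mu>"
      using that c by (intro mult_left_mono powr_mono2) auto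
    finally show ?thesis .
  qed
  obtain J where J: "\<forall>s t. 0 \<le> s \<and> s \<le> t \<and> t - s \<le> b - a \<longrightarrow>
      norm (J t - J s - f (c s) *v (g (c t) - g (c s)))
        \<le> young_const (\<alpha> + \<beta>) * (L * G * (t - s) powr (\<alpha> + \<beta>))"
    using sewing[of "b - a" L G \<alpha> \<beta> "\<lambda>u. f (c u)" "\<lambda>u. g (c u)"] assms clip[OF f] clip[OF g] by auto
  have "c (s - a) = s" if "a \<le> s" "s \<le> b" for s
    using that by (auto simp: c_def)
  then have "norm (J (t - a) - J (s - a) - f s *v (g t - g s))
      \<le> young_const (\<alpha> + \<beta>) * (L * G * (t - s) powr (\<alpha> + \<beta>))" if "a \<le> s" "s \<le> t" "t \<le> b" for s t
    using J[rule_format, of "s - a" "t - a"] that by simp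
  then show ?thesis
    by (intro exI[of _ "\<lambda>t. J (t - a)"]) blast
qed

section \<open>Convergence of Riemann--Stieltjes sums\<close>

text \<open>Tagged divisions of arbitrarily small mesh exist, as divisions fine for a constant
  gauge, so two limits cannot differ. This justifies the description operator in
  \<open>young_integral\<close>.\<close>

lemma has_young_integral_unique:
  assumes "a \<le> b" "has_young_integral f g a b I" "has_young_integral f g a b I'"
  shows "I = I'"
proof (rule ccontr)
  assume "I \<noteq> I'"
  then have e: "norm (I - I') / 2 > 0" by simp
  obtain d1 where d1: "d1 > 0" "\<And>p. p tagged_division_of {a..b} \<and> (\<forall>(\<xi>, k)\<in>p. Sup k - Inf k < d1) \<Longrightarrow>
      norm ((\<Sum>(\<xi>, k)\<in>p. f \<xi> *v (g (Sup k) - g (Inf k))) - I) < norm (I - I') / 2"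
    using assms(2) e unfolding has_young_integral_def by meson
  obtain d2 where d2: "d2 > 0" "\<And>p. p tagged_division_of {a..b} \<and> (\<forall>(\<xi>, k)\<in>p. Sup k - Inf k < d2) \<Longrightarrow>
      norm ((\<Sum>(\<xi>, k)\<in>p. f \<xi> *v (g (Sup k) - g (Inf k))) - I') < norm (I - I') / 2"
    using assms(3) e unfolding has_young_integral_def by meson
  \<comment> \<open>A cell inside the ball of radius \<open>d\<close> about its tag is shorter than
    \<open>2 * d\<close>, hence than \<open>d1\<close> and \<open>d2\<close>.\<close>
  define d where "d = min d1 d2 / 3"
  have "d > 0" using d1 d2 by (simp add: d_def)
  then have "gauge (\<lambda>x. ball x d)" by auto
  then obtain p where p: "p tagged_division_of {a..b}" "(\<lambda>x. ball x d) fine p"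
    using fine_division_exists_real by blast
  have mesh: "Sup k - Inf k < 3 * d" if k_in: "(\<xi>, k) \<in> p" for \<xi> k
  proof -
    obtain u v where k: "k = {u..v}" using tagged_division_ofD(4)[OF p(1) k_in] by auto
    have "\<xi> \<in> k" using tagged_division_ofD(2)[OF p(1) k_in] .
    moreover have "k \<subseteq> ball \<xi> d" using p(2) k_in by (auto simp: fine_def)
    ultimately have "u \<le> v" "u \<in> ball \<xi> d" "v \<in> ball \<xi> d"
      unfolding k using subsetD[of "{u..v}" "ball \<xi> d" u] subsetD[of "{u..v}" "ball \<xi> d" v] by auto
    then show ?thesis using \<open>d > 0\<close> unfolding k by (auto simp: dist_real_def)
  qed
  have "norm ((\<Sum>(\<xi>, k)\<in>p. f \<xi> *v (g (Sup k) - g (Inf k))) - I) < norm (I - I') / 2"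
    using mesh p(1) by (intro d1(2)) (fastforce simp: d_def)
  moreover have "norm ((\<Sum>(\<xi>, k)\<in>p. f \<xi> *v (g (Sup k) - g (Inf k))) - I') < norm (I - I') / 2"
    using mesh p(1) by (intro d2(2)) (fastforce simp: d_def)
  ultimately show False by norm
qed

text \<open>The increments of \<open>J\<close> telescope over a division, and each cell contributes
  an error of at most \<open>M\<close> times its length times the mesh to the power
  \<open>\<theta> - 1\<close>. The total is thus at most \<open>M * (b - a)\<close> times a
  vanishing factor.\<close>

lemma has_young_integral_of_germ:
  fixes f :: "real \<Rightarrow> real^'m^'d"
  assumes "a \<le> b" "\<theta> > 1" "M \<ge> 0"
    and J: "\<And>\<xi> u v. \<lbrakk>a \<le> u; u \<le> \<xi>; \<xi> \<le> v; v \<le> b\<rbrakk>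
      \<Longrightarrow> norm (J v - J u - f \<xi> *v (g v - g u)) \<le> M * (v - u) powr \<theta>"
  shows "has_young_integral f g a b (J b - J a)"
  unfolding has_young_integral_def
proof (intro allI impI)
  fix \<epsilon> :: real
  assume "\<epsilon> > 0"
  \<comment> \<open>Chosen so that \<open>M * e * (b - a)\<close> is at most
    \<open>\<epsilon> / 2\<close>; adding 1 avoids a zero denominator when \<open>M = 0\<close> or
    \<open>a = b\<close>.\<close>
  define e where "e = \<epsilon> / (2 * (M + 1) * (b - a + 1))"
  have "e > 0" using \<open>\<epsilon> > 0\<close> assms by (simp add: e_def)
  define d where "d = e powr (1 / (\<theta> - 1))"
  have "d > 0" using \<open>e > 0\<close> by (simp add: d_def)
  have de: "d powr (\<theta> - 1) = e"
    using \<open>e > 0\<close> \<open>\<theta> > 1\<close> by (simp add: d_def powr_powr)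
  show "\<exists>\<delta>>0. \<forall>p. p tagged_division_of {a..b} \<and> (\<forall>(\<xi>, k)\<in>p. Sup k - Inf k < \<delta>) \<longrightarrow>
      norm ((\<Sum>(\<xi>, k)\<in>p. f \<xi> *v (g (Sup k) - g (Inf k))) - (J b - J a)) < \<epsilon>"
  proof (intro exI conjI allI impI)
    show "d > 0" by fact
    fix p
    assume "p tagged_division_of {a..b} \<and> (\<forall>(\<xi>, k)\<in>p. Sup k - Inf k < d)"
    then have p: "p tagged_division_of {a..b}" and mesh: "\<And>\<xi> k. (\<xi>, k) \<in> p \<Longrightarrow> Sup k - Inf k < d"
      by auto
    have "(\<Sum>(\<xi>, k)\<in>p. f \<xi> *v (g (Sup k) - g (Inf k))) - (J b - J a)
        = (\<Sum>(\<xi>, k)\<in>p. f \<xi> *v (g (Sup k) - g (Inf k)) - (J (Sup k) - J (Inf k)))"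
      using additive_tagged_division_1[OF \<open>a \<le> b\<close> p, of J] by (simp add: sum_subtractf case_prod_unfold)
    also have "norm \<dots> \<le> (\<Sum>(\<xi>, k)\<in>p. M * e * (Sup k - Inf k))"
    proof (intro sum_norm_le, clarify)
      fix \<xi> k
      assume k: "(\<xi>, k) \<in> p"
      obtain u v where uv: "k = {u..v}" using tagged_division_ofD(4)[OF p k] by auto
      have \<xi>: "u \<le> \<xi>" "\<xi> \<le> v" using tagged_division_ofD(2)[OF p k] uv by auto
      have ab: "a \<le> u" "v \<le> b" using tagged_division_ofD(3)[OF p k] uv \<xi> by auto
      have si: "Sup k = v" "Inf k = u" using uv \<xi> by auto
      have "norm (f \<xi> *v (g v - g u) - (J v - J u)) \<le> M * (v - u) powr \<theta>"
        using J[OF ab(1) \<xi> ab(2)] by (simp add: norm_minus_commute)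
      also have "(v - u) powr \<theta> = (v - u) powr (\<theta> - 1) * (v - u)"
        using \<xi> by (cases "u = v") (auto simp: powr_diff)
      also have "M * ((v - u) powr (\<theta> - 1) * (v - u)) \<le> M * (e * (v - u))"
        using mesh[OF k] \<xi> \<open>M \<ge> 0\<close> \<open>\<theta> > 1\<close> unfolding si de[symmetric]
        by (intro mult_left_mono mult_right_mono powr_mono2) auto
      finally show "norm (f \<xi> *v (g (Sup k) - g (Inf k)) - (J (Sup k) - J (Inf k))) \<le> M * e * (Sup k - Inf k)"
        by (simp add: si mult_ac)
    qed
    also have "\<dots> = M * e * (\<Sum>(\<xi>, k)\<in>p. Sup k - Inf k)"
      by (simp add: sum_distrib_left case_prod_unfold)
    also have "(\<Sum>(\<xi>, k)\<in>p. Sup k - Inf k) = b - a"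
      using additive_tagged_division_1[OF \<open>a \<le> b\<close> p, of "\<lambda>x. x"] by simp
    also have "M * e * (b - a) \<le> (M + 1) * e * (b - a + 1)"
      using assms \<open>e > 0\<close> by (intro mult_mono) auto
    also have "\<dots> = \<epsilon> / 2"
    proof -
      have "M + 1 \<noteq> 0" "b - a + 1 \<noteq> 0" using assms by linarith+
      then show ?thesis unfolding e_def by (simp add: divide_simps)
    qed
    also have "\<dots> < \<epsilon>" using \<open>\<epsilon> > 0\<close> by simp
    finally show "norm ((\<Sum>(\<xi>, k)\<in>p. f \<xi> *v (g (Sup k) - g (Inf k))) - (J b - J a)) < \<epsilon>" .
  qed
qed

text \<open>Moving the tag from the left end of a cell to any other point costs an error of the same
  order \<open>\<alpha> + \<beta>\<close>, so the Young--Loeve estimate implies the premise of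
  \<open>has_young_integral_of_germ\<close>. A single \<open>J\<close> for all subintervals also
  gives additivity.\<close>

lemma hoelder_young_integral:
  fixes f :: "real \<Rightarrow> real^'m^'d" and g :: "real \<Rightarrow> real^'m"
  assumes "a < b" "L \<ge> 0" "G \<ge> 0" "\<alpha> > 0" "\<beta> > 0" "\<alpha> + \<beta> > 1"
    and f: "\<And>u v. \<lbrakk>a \<le> u; u \<le> v; v \<le> b\<rbrakk> \<Longrightarrow> norm (f v - f u) \<le> L * (v - u) powr \<alpha>"
    and g: "\<And>u v. \<lbrakk>a \<le> u; u \<le> v; v \<le> b\<rbrakk> \<Longrightarrow> norm (g v - g u) \<le> G * (v - u) powr \<beta>"
  shows "\<exists>J. \<forall>s t. a \<le> s \<and> s \<le> t \<and> t \<le> b \<longrightarrow> has_young_integral f g s t (J t - J s) \<and>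
    norm (J t - J s - f s *v (g t - g s)) \<le> young_const (\<alpha> + \<beta>) * (L * G * (t - s) powr (\<alpha> + \<beta>))"
proof -
  obtain J where J: "\<And>s t. \<lbrakk>a \<le> s; s \<le> t; t \<le> b\<rbrakk> \<Longrightarrow>
      norm (J t - J s - f s *v (g t - g s)) \<le> young_const (\<alpha> + \<beta>) * (L * G * (t - s) powr (\<alpha> + \<beta>))"
    using young_loeve[of a b L G \<alpha> \<beta> f g] assms by blast
  define M where "M = young_const (\<alpha> + \<beta>) * (L * G) + L * G"
  have M: "M \<ge> 0" using assms young_const_nonneg by (simp add: M_def)
  have "norm (J v - J u - f \<xi> *v (g v - g u)) \<le> M * (v - u) powr (\<alpha> + \<beta>)"
    if "a \<le> u" "u \<le> \<xi>" "\<xi> \<le> v" "v \<le> b" for \<xi> u v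
  proof -
    have "norm ((f \<xi> - f u) *v (g v - g u)) \<le> (L * (v - u) powr \<alpha>) * (G * (v - u) powr \<beta>)"
    proof (intro order_trans[OF norm_matrix_vector_mult_le] mult_mono)
      have "norm (f \<xi> - f u) \<le> L * (\<xi> - u) powr \<alpha>" using that by (intro f) auto
      also have "\<dots> \<le> L * (v - u) powr \<alpha>" using that assms by (intro mult_left_mono powr_mono2) auto
      finally show "norm (f \<xi> - f u) \<le> L * (v - u) powr \<alpha>" .
      show "norm (g v - g u) \<le> G * (v - u) powr \<beta>" using that by (intro g) auto
    qed (use assms in auto)
    also have "\<dots> = L * G * (v - u) powr (\<alpha> + \<beta>)" by (simp add: powr_add mult_ac)
    finally have "norm ((f \<xi> - f u) *v (g v - g u)) \<le> L * G * (v - u) powr (\<alpha> + \<beta>)" .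
    moreover have "norm (J v - J u - f u *v (g v - g u)) \<le> young_const (\<alpha> + \<beta>) * (L * G * (v - u) powr (\<alpha> + \<beta>))"
      using that by (intro J) auto
    moreover have "J v - J u - f \<xi> *v (g v - g u) = (J v - J u - f u *v (g v - g u)) - (f \<xi> - f u) *v (g v - g u)"
      by (simp add: matrix_vector_mult_diff_rdistrib)
    ultimately show ?thesis
      unfolding M_def by (smt (verit) distrib_right mult.assoc norm_triangle_ineq4)
  qed
  then have "has_young_integral f g s t (J t - J s)" if "a \<le> s" "s \<le> t" "t \<le> b" for s t
    using that assms M by (intro has_young_integral_of_germ[where \<theta> = "\<alpha> + \<beta>" and M = M]) auto
  then show ?thesis using J by blast
qed

lemma young_integral_eq:
  "a \<le> b \<Longrightarrow> has_young_integral f g a b I \<Longrightarrow> young_integral f g a b = I"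
  unfolding young_integral_def by (blast intro: has_young_integral_unique)

section \<open>Increments of reflected solutions\<close>

lemma hoelder_seminorm_bound:
  assumes "f \<in> hoelder_space \<mu> T" "0 \<le> u" "u \<le> v" "v \<le> T"
  shows "norm (f v - f u) \<le> hoelder_seminorm \<mu> T f * (v - u) powr \<mu>"
proof (cases "u = v")
  case False
  then have "norm (f v - f u) / (v - u) powr \<mu> \<in> hoelder_quotients \<mu> T f"
    using assms unfolding hoelder_quotients_def by (intro CollectI exI[of _ u] exI[of _ v]) auto
  then have "norm (f v - f u) / (v - u) powr \<mu> \<le> hoelder_seminorm \<mu> T f"
    using assms(1) unfolding hoelder_seminorm_def hoelder_space_def by (auto intro: cSup_upper)
  then show ?thesis using False assms by (simp add: pos_divide_le_eq)
qed simp

lemma hoelder_seminorm_nonneg: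
  assumes "f \<in> hoelder_space \<mu> T" "T > 0"
  shows "hoelder_seminorm \<mu> T f \<ge> 0"
proof -
  have "0 \<le> hoelder_seminorm \<mu> T f * T powr \<mu>"
    using hoelder_seminorm_bound[OF assms(1), of 0 T] \<open>T > 0\<close> norm_ge_zero[of "f T - f 0"] 
    by (intro order_trans[OF norm_ge_zero[of "f T - f 0"]]) auto
  then show ?thesis using \<open>T > 0\<close> by (simp add: zero_le_mult_iff)
qed

lemma hoelder_seminorm_le:
  assumes "T > 0" "\<And>u v. \<lbrakk>0 \<le> u; u \<le> v; v \<le> T\<rbrakk> \<Longrightarrow> norm (f v - f u) \<le> c * (v - u) powr \<mu>"
  shows "hoelder_seminorm \<mu> T f \<le> c"
  unfolding hoelder_seminorm_def
proof (rule cSup_least)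
  show "hoelder_quotients \<mu> T f \<noteq> {}"
    using \<open>T > 0\<close> unfolding hoelder_quotients_def by auto
  fix q
  assume "q \<in> hoelder_quotients \<mu> T f"
  then show "q \<le> c"
    using assms(2) by (auto simp: hoelder_quotients_def pos_divide_le_eq)
qed

text \<open>In each component, the running maximum can grow after time \<open>s\<close> by at most
  the oscillation of \<open>z\<close> measured from \<open>s\<close>. Summing over components gives
  the dimensional factor; \<open>W\<close> ensures that the real suprema are meaningful.\<close>

lemma regulator_increment:
  fixes z :: "real \<Rightarrow> real^'d"
  assumes st: "0 \<le> s" "s \<le> t"
    and w: "\<And>u. \<lbrakk>s \<le> u; u \<le> t\<rbrakk> \<Longrightarrow> norm (z u - z s) \<le> w"
    and W: "\<And>u. \<lbrakk>0 \<le> u; u \<le> t\<rbrakk> \<Longrightarrow> norm (z u) \<le> W"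
  shows "norm (regulator z t - regulator z s) \<le> real CARD('d) * w"
proof -
  have "\<bar>regulator z t $ i - regulator z s $ i\<bar> \<le> w" for i
  proof -
    define h where "h u = max (- (z u $ i)) 0" for u
    have "h u \<le> W" if "0 \<le> u" "u \<le> t" for u
      using W[OF that] component_le_norm_cart[of "z u" i] by (auto simp: h_def)
    then have bdd: "bdd_above (h ` {0..t})" "bdd_above (h ` {0..s})"
      using st by (auto intro!: bdd_aboveI2[of _ _ W])
    have "(SUP u\<in>{0..s}. h u) \<le> (SUP u\<in>{0..t}. h u)"
      using st bdd by (intro cSUP_subset_mono) auto
    moreover have "(SUP u\<in>{0..t}. h u) \<le> (SUP u\<in>{0..s}. h u) + w"
    proof (rule cSUP_least)
      fix u
      assume u: "u \<in> {0..t}"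
      show "h u \<le> (SUP u\<in>{0..s}. h u) + w"
      proof (cases "u \<le> s")
        case True
        then have "h u \<le> (SUP u\<in>{0..s}. h u)" using u bdd by (intro cSUP_upper) auto
        moreover have "0 \<le> w" using w[of s] st by simp
        ultimately show ?thesis by simp
      next
        case False
        have "\<bar>(z u - z s) $ i\<bar> \<le> w"
          using w[of u] component_le_norm_cart[of "z u - z s" i] u False by auto
        then have "h u \<le> h s + w" by (auto simp: h_def)
        moreover have "h s \<le> (SUP u\<in>{0..s}. h u)" using st bdd by (intro cSUP_upper) auto
        ultimately show ?thesis by simp
      qed
    qed (use st in auto)
    ultimately show ?thesis by (simp add: regulator_def h_def)
  qed
  then have "norm (regulator z t - regulator z s) \<le> (\<Sum>i\<in>(UNIV :: 'd set). w)"
    by (intro order_trans[OF norm_le_l1_cart] sum_mono) simp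
  then show ?thesis by simp
qed

text \<open>Two Hoelder constants of the integrand occur: \<open>L'\<close> on all of
  \<open>[0,T]\<close> provides the integral from 0 and its additivity, while only the local
  \<open>L\<close> enters the estimate. This locality is what later permits absorption on short
  intervals.\<close>

lemma unreflected_path_increment:
  fixes b :: "real \<Rightarrow> real^'d \<Rightarrow> real^'d" and \<sigma> :: "real \<Rightarrow> real^'d \<Rightarrow> real^'m^'d"
  assumes T: "T > 0" and st: "0 \<le> s" "s \<le> t" "t \<le> T"
    and exps: "\<alpha> > 0" "\<beta> > 0" "\<alpha> + \<beta> > 1"
    and nonneg: "B \<ge> 0" "G \<ge> 0" "L \<ge> 0" "L' \<ge> 0"
    and int: "set_integrable lebesgue {0..T} (\<lambda>r. b r (x r))"
    and B: "\<And>r. r \<in> {0..T} \<Longrightarrow> norm (b r (x r)) \<le> B"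
    and S: "\<And>r. r \<in> {0..T} \<Longrightarrow> norm (\<sigma> r (x r)) \<le> S"
    and g: "\<And>u v. \<lbrakk>0 \<le> u; u \<le> v; v \<le> T\<rbrakk> \<Longrightarrow> norm (g v - g u) \<le> G * (v - u) powr \<beta>"
    and L': "\<And>u v. \<lbrakk>0 \<le> u; u \<le> v; v \<le> T\<rbrakk> \<Longrightarrow> norm (\<sigma> v (x v) - \<sigma> u (x u)) \<le> L' * (v - u) powr \<alpha>"
    and L: "\<And>u v. \<lbrakk>s \<le> u; u \<le> v; v \<le> t\<rbrakk> \<Longrightarrow> norm (\<sigma> v (x v) - \<sigma> u (x u)) \<le> L * (v - u) powr \<alpha>"
  shows "norm (unreflected_path b \<sigma> g x0 x t - unreflected_path b \<sigma> g x0 x s)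
    \<le> B * (t - s) + S * G * (t - s) powr \<beta> + young_const (\<alpha> + \<beta>) * (L * G * (t - s) powr (\<alpha> + \<beta>))"
proof (cases "s = t")
  case True
  then show ?thesis by simp
next
  case False
  define f where "f r = \<sigma> r (x r)" for r
  define c where "c r = b r (x r)" for r
  have "\<exists>J. \<forall>u v. 0 \<le> u \<and> u \<le> v \<and> v \<le> T \<longrightarrow> has_young_integral f g u v (J v - J u) \<and>
      norm (J v - J u - f u *v (g v - g u)) \<le> young_const (\<alpha> + \<beta>) * (L' * G * (v - u) powr (\<alpha> + \<beta>))"
    unfolding f_def by (rule hoelder_young_integral) (use T exps nonneg g L' in auto)
  then obtain J where J: "\<And>u v. \<lbrakk>0 \<le> u; u \<le> v; v \<le> T\<rbrakk> \<Longrightarrow> has_young_integral f g u v (J v - J u)"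
    by blast
  have "\<exists>J. \<forall>u v. s \<le> u \<and> u \<le> v \<and> v \<le> t \<longrightarrow> has_young_integral f g u v (J v - J u) \<and>
      norm (J v - J u - f u *v (g v - g u)) \<le> young_const (\<alpha> + \<beta>) * (L * G * (v - u) powr (\<alpha> + \<beta>))"
    unfolding f_def by (rule hoelder_young_integral) (use False st exps nonneg g L in auto)
  then obtain J' where J': "has_young_integral f g s t (J' t - J' s)"
    "norm (J' t - J' s - f s *v (g t - g s)) \<le> young_const (\<alpha> + \<beta>) * (L * G * (t - s) powr (\<alpha> + \<beta>))"
    using st by blast
  \<comment> \<open>Uniqueness of the integral transfers the local estimate to the global
    path.\<close>
  have "J t - J s = J' t - J' s"
    using J[of s t] J'(1) st by (intro has_young_integral_unique[of s t f g]) auto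
  then have young: "norm (J t - J s - f s *v (g t - g s)) \<le> young_const (\<alpha> + \<beta>) * (L * G * (t - s) powr (\<alpha> + \<beta>))"
    using J'(2) by simp
  \<comment> \<open>The Lebesgue integral is rewritten as a Henstock--Kurzweil integral, for which
    splitting at \<open>s\<close> and the bound on \<open>[s,t]\<close> are available.\<close>
  have path: "unreflected_path b \<sigma> g x0 x r = x0 + integral {0..r} c + (J r - J 0)" if "0 \<le> r" "r \<le> T" for r
  proof -
    have "set_integrable lebesgue {0..r} c"
      unfolding c_def using that by (intro set_integrable_subset[OF int]) auto
    then have "(LINT s:{0..r}|lebesgue. c s) = integral {0..r} c"
      by (rule set_lebesgue_integral_eq_integral)
    moreover have "young_integral f g 0 r = J r - J 0"
      using that J by (intro young_integral_eq) auto
    ultimately show ?thesis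
      by (simp add: unreflected_path_def f_def[abs_def] c_def[abs_def])
  qed
  have c_int: "c integrable_on {0..t}"
  proof -
    have "set_integrable lebesgue {0..t} c"
      unfolding c_def using st by (intro set_integrable_subset[OF int]) auto
    then show ?thesis by (rule set_lebesgue_integral_eq_integral)
  qed
  have split: "integral {0..t} c = integral {0..s} c + integral {s..t} c"
    using st c_int by (intro sym[OF Henstock_Kurzweil_Integration.integral_combine]) auto
  then have eq: "unreflected_path b \<sigma> g x0 x t - unreflected_path b \<sigma> g x0 x s =
      integral {s..t} c + f s *v (g t - g s) + (J t - J s - f s *v (g t - g s))"
    using path[of t] path[of s] st by (simp add: split)
  have "c integrable_on {s..t}"
    using c_int st by (auto intro: integrable_subinterval_real)
  then have "(c has_integral integral {s..t} c) {s..t}" by (rule integrable_integral)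
  then have c: "norm (integral {s..t} c) \<le> B * (t - s)"
    using has_integral_bound_real[of B "{}" c _ s t] B st nonneg by (auto simp: c_def)
  have S0: "0 \<le> S" using S[of 0] T by (auto intro: order_trans[OF norm_ge_zero])
  have "norm (f s *v (g t - g s)) \<le> S * (G * (t - s) powr \<beta>)"
    unfolding f_def using S[of s] g[of s t] st S0
    by (intro order_trans[OF norm_matrix_vector_mult_le] mult_mono) auto
  then have f: "norm (f s *v (g t - g s)) \<le> S * G * (t - s) powr \<beta>" by (simp add: mult_ac)
  show ?thesis
    unfolding eq by (intro norm_triangle_mono c f young)
qed

text \<open>As \<open>young_integral\<close> is defined by description, its value 0 on a degenerate
  interval has to come from existence.\<close>

lemma unreflected_path_0:
  assumes "T > 0" "\<alpha> > 0" "\<beta> > 0" "\<alpha> + \<beta> > 1" "G \<ge> 0" "L \<ge> 0"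
    and "\<And>u v. \<lbrakk>0 \<le> u; u \<le> v; v \<le> T\<rbrakk> \<Longrightarrow> norm (g v - g u) \<le> G * (v - u) powr \<beta>"
    and "\<And>u v. \<lbrakk>0 \<le> u; u \<le> v; v \<le> T\<rbrakk> \<Longrightarrow> norm (\<sigma> v (x v) - \<sigma> u (x u)) \<le> L * (v - u) powr \<alpha>"
    and "set_integrable lebesgue {0..T} (\<lambda>r. b r (x r))"
  shows "unreflected_path b \<sigma> g x0 x 0 = x0"
proof -
  have "\<exists>J. \<forall>u v. 0 \<le> u \<and> u \<le> v \<and> v \<le> T \<longrightarrow> has_young_integral (\<lambda>r. \<sigma> r (x r)) g u v (J v - J u) \<and>
      norm (J v - J u - \<sigma> u (x u) *v (g v - g u)) \<le> young_const (\<alpha> + \<beta>) * (L * G * (v - u) powr (\<alpha> + \<beta>))"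
    by (rule hoelder_young_integral) (use assms in auto)
  then obtain J where J: "\<And>u v. \<lbrakk>0 \<le> u; u \<le> v; v \<le> T\<rbrakk> \<Longrightarrow> has_young_integral (\<lambda>r. \<sigma> r (x r)) g u v (J v - J u)"
    by blast
  from J[of 0 0] \<open>T > 0\<close> have "young_integral (\<lambda>r. \<sigma> r (x r)) g 0 0 = 0"
    by (intro young_integral_eq) auto
  moreover have "(LINT r:{0..0}|lebesgue. b r (x r)) = integral {0..0} (\<lambda>r. b r (x r))"
    using \<open>T > 0\<close> by (intro set_lebesgue_integral_eq_integral set_integrable_subset[OF assms(9)]) auto
  ultimately show ?thesis
    by (simp add: unreflected_path_def)
qed

text \<open>The solution is \<open>z\<close> plus its regulator, whose increment is at most
  \<open>CARD('d)\<close> times the oscillation of \<open>z\<close>; this explains the factor in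
  front.\<close>

lemma reflected_increment:
  fixes b :: "real \<Rightarrow> real^'d \<Rightarrow> real^'d" and \<sigma> :: "real \<Rightarrow> real^'d \<Rightarrow> real^'m^'d"
  assumes T: "T > 0" and x0: "\<And>i. x0 $ i > 0"
    and sol: "is_reflected_solution T b \<sigma> g x0 x"
    and exps: "\<alpha> > 0" "\<beta> > 0" "\<alpha> + \<beta> > 1"
    and nonneg: "B \<ge> 0" "G \<ge> 0" "L \<ge> 0" "L' \<ge> 0"
    and B: "\<And>r. r \<in> {0..T} \<Longrightarrow> norm (b r (x r)) \<le> B"
    and S: "\<And>r. r \<in> {0..T} \<Longrightarrow> norm (\<sigma> r (x r)) \<le> S"
    and g: "\<And>u v. \<lbrakk>0 \<le> u; u \<le> v; v \<le> T\<rbrakk> \<Longrightarrow> norm (g v - g u) \<le> G * (v - u) powr \<beta>"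
    and L': "\<And>u v. \<lbrakk>0 \<le> u; u \<le> v; v \<le> T\<rbrakk> \<Longrightarrow> norm (\<sigma> v (x v) - \<sigma> u (x u)) \<le> L' * (v - u) powr \<alpha>"
    and st: "0 \<le> s" "s \<le> t" "t \<le> T"
    and L: "\<And>u v. \<lbrakk>s \<le> u; u \<le> v; v \<le> t\<rbrakk> \<Longrightarrow> norm (\<sigma> v (x v) - \<sigma> u (x u)) \<le> L * (v - u) powr \<alpha>"
  shows "norm (x t - x s) \<le> (1 + real CARD('d)) *
    (B * (t - s) + S * G * (t - s) powr \<beta> + young_const (\<alpha> + \<beta>) * (L * G * (t - s) powr (\<alpha> + \<beta>)))"
proof -
  define z where "z = unreflected_path b \<sigma> g x0 x"
  define \<omega> where "\<omega> M h = B * h + S * G * h powr \<beta> + young_const (\<alpha> + \<beta>) * (M * G * h powr (\<alpha> + \<beta>))" for M h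
  have int: "set_integrable lebesgue {0..T} (\<lambda>r. b r (x r))"
    using sol by (simp add: is_reflected_solution_def)
  have S0: "0 \<le> S" using S[of 0] T by (auto intro: order_trans[OF norm_ge_zero])
  have C0: "0 \<le> young_const (\<alpha> + \<beta>)" using exps by (intro young_const_nonneg)
  have \<omega>_mono: "\<omega> M h \<le> \<omega> M k" if "0 \<le> h" "h \<le> k" "0 \<le> M" for M h k
  proof -
    have "h powr \<beta> \<le> k powr \<beta>" "h powr (\<alpha> + \<beta>) \<le> k powr (\<alpha> + \<beta>)"
      using that exps by (auto intro!: powr_mono2)
    then show ?thesis
      unfolding \<omega>_def using that S0 C0 nonneg by (intro add_mono mult_left_mono mult_nonneg_nonneg)
  qed
  have z_inc: "norm (z u - z s) \<le> \<omega> L (t - s)" if "s \<le> u" "u \<le> t" for u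
  proof -
    have "u \<le> T" using that st by simp
    have "norm (z u - z s) \<le> \<omega> L (u - s)"
      unfolding z_def \<omega>_def
    proof (rule unreflected_path_increment[where T = T and L' = L'])
      show "norm (\<sigma> q (x q) - \<sigma> p (x p)) \<le> L * (q - p) powr \<alpha>" if "s \<le> p" "p \<le> q" "q \<le> u" for p q
        using that \<open>u \<le> t\<close> by (intro L) auto
    qed fact+
    also have "\<dots> \<le> \<omega> L (t - s)" using that nonneg by (intro \<omega>_mono) auto
    finally show ?thesis .
  qed
  have z0: "z 0 = x0"
    unfolding z_def using T exps \<open>G \<ge> 0\<close> \<open>L' \<ge> 0\<close> g L' int by (rule unreflected_path_0)
  \<comment> \<open>Boundedness of \<open>z\<close> from time 0 on requires the global constant
    \<open>L'\<close>.\<close>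
  have z_bdd: "norm (z u) \<le> norm x0 + \<omega> L' T" if "0 \<le> u" "u \<le> t" for u
  proof -
    have "u \<le> T" using that st by simp
    have "norm (z u - z 0) \<le> \<omega> L' (u - 0)"
      unfolding z_def \<omega>_def
    proof (rule unreflected_path_increment[where T = T and L' = L'])
      show "norm (\<sigma> q (x q) - \<sigma> p (x p)) \<le> L' * (q - p) powr \<alpha>" if "0 \<le> p" "p \<le> q" "q \<le> u" for p q
        using that \<open>u \<le> T\<close> by (intro L') auto
    qed (fact | simp)+
    also have "\<dots> \<le> \<omega> L' T" using that st nonneg by (intro \<omega>_mono) auto
    finally show ?thesis unfolding z0 using norm_triangle_sub[of "z u" x0] by linarith
  qed
  have y: "norm (regulator z t - regulator z s) \<le> real CARD('d) * \<omega> L (t - s)"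
    using st z_inc z_bdd by (intro regulator_increment)
  have "x r = z r + regulator z r" if "0 \<le> r" "r \<le> T" for r
  proof (cases "r = 0")
    case True
    \<comment> \<open>The equation is imposed only for positive times; at time 0 the decomposition
      holds because the components of \<open>x0\<close> are positive.\<close>
    have "regulator z 0 = 0"
      by (simp add: regulator_def z0 vec_eq_iff max_absorb2 less_imp_le[OF x0])
    then show ?thesis using True sol z0 by (simp add: is_reflected_solution_def)
  next
    case False
    then show ?thesis using sol that by (simp add: is_reflected_solution_def z_def)
  qed
  then have eq: "x t - x s = (z t - z s) + (regulator z t - regulator z s)"
    using st by simp
  have "norm (x t - x s) \<le> \<omega> L (t - s) + real CARD('d) * \<omega> L (t - s)"
    unfolding eq using z_inc[of t] st y by (intro norm_triangle_mono) auto
  then show ?thesis unfolding \<omega>_def by (simp add: distrib_right)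
qed

section \<open>The a priori estimate\<close>

text \<open>On intervals of length at most \<open>\<Delta>\<close>, \<open>loc\<close> improves a
  Hoelder constant \<open>N\<close> to \<open>A + N / 2\<close>, so iteration leads to
  \<open>2 * A\<close>. Chaining over cells of length \<open>\<Delta>\<close> then costs a factor of
  order \<open>1 / \<Delta>\<close>, which is the power \<open>1 / \<beta>\<close>. The 1 in
  \<open>\<kappa>\<close> keeps it positive when \<open>K = 0\<close>.\<close>

lemma a_priori_bound:
  fixes x :: "real \<Rightarrow> 'a::real_normed_vector"
  assumes "T > 0" "0 < \<alpha>" "\<alpha> < \<beta>" "\<beta> \<le> 1" "0 \<le> B" "0 \<le> S" "0 \<le> K" "0 \<le> G" "0 \<le> N'" "0 \<le> P"
    and glob: "\<And>u v. \<lbrakk>0 \<le> u; u \<le> v; v \<le> T\<rbrakk> \<Longrightarrow> norm (x v - x u) \<le> N' * (v - u) powr \<alpha>"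
    and loc: "\<And>N s t. \<lbrakk>0 \<le> N; 0 \<le> s; s \<le> t; t \<le> T;
        \<And>u v. \<lbrakk>s \<le> u; u \<le> v; v \<le> t\<rbrakk> \<Longrightarrow> norm (x v - x u) \<le> N * (v - u) powr \<alpha>\<rbrakk>
      \<Longrightarrow> norm (x t - x s) \<le> B * (t - s) + S * G * (t - s) powr \<beta> + K * (P + N) * G * (t - s) powr (\<alpha> + \<beta>)"
    and st: "0 \<le> s" "s \<le> t" "t \<le> T"
  defines "\<kappa> \<equiv> 2 * K + 1"
  defines "M \<equiv> 2 * (B * T + S / \<kappa>) + P * T powr \<alpha>"
  shows "norm (x t - x s) \<le> 3 * M * T powr (1 - \<alpha>) * (T powr (- \<beta>) + \<kappa> * G) powr (1 / \<beta>) * (t - s) powr \<alpha>"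
proof -
  have "\<kappa> > 0" "\<beta> > 0" using assms by (auto simp: \<kappa>_def)
  \<comment> \<open>A smooth substitute for \<open>min T ((\<kappa> * G) powr (- 1 / \<beta>))\<close>, also meaningful for \<open>G = 0\<close>.\<close>
  define R where "R = T powr (- \<beta>) + \<kappa> * G"
  have "R > 0" using \<open>T > 0\<close> \<open>\<kappa> > 0\<close> \<open>0 \<le> G\<close> by (auto simp: R_def intro: add_pos_nonneg)
  \<comment> \<open>With this choice \<open>\<Delta> powr \<beta> = 1 / R\<close>: the second
    summand of \<open>R\<close> gives \<open>K * G * \<Delta> powr \<beta> \<le> 1 / 2\<close>, the
    first gives \<open>\<Delta> \<le> T\<close>.\<close>
  define \<Delta> where "\<Delta> = R powr (- (1 / \<beta>))"
  have "\<Delta> > 0" using \<open>R > 0\<close> by (simp add: \<Delta>_def)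
  have \<Delta>_pow: "\<Delta> powr \<beta> = 1 / R"
    using \<open>R > 0\<close> \<open>\<beta> > 0\<close> powr_minus_divide[of R 1] by (simp add: \<Delta>_def powr_powr)
  have "\<kappa> * G \<le> R" by (simp add: R_def)
  then have \<kappa>G: "\<kappa> * (G * \<Delta> powr \<beta>) \<le> 1"
    unfolding \<Delta>_pow using \<open>R > 0\<close> by (simp add: field_simps)
  have "\<Delta> \<le> T"
  proof -
    have "R powr (- (1 / \<beta>)) \<le> (T powr (- \<beta>)) powr (- (1 / \<beta>))"
      using \<open>T > 0\<close> \<open>\<kappa> > 0\<close> \<open>0 \<le> G\<close> \<open>\<beta> > 0\<close> by (intro powr_mono2') (auto simp: R_def)
    then show ?thesis using \<open>\<beta> > 0\<close> \<open>T > 0\<close> by (simp add: \<Delta>_def powr_powr)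
  qed
  \<comment> \<open>Collects the terms of \<open>loc\<close> without \<open>N\<close> after division
    by \<open>h powr \<alpha>\<close>; \<open>P / 2\<close> comes from the same absorption that
    gives \<open>N / 2\<close>.\<close>
  define A where "A = B * \<Delta> powr (1 - \<alpha>) + S * G * \<Delta> powr (\<beta> - \<alpha>) + P / 2"
  have "A \<ge> 0" using assms by (auto simp: A_def)
  have improve: "norm (x v - x u) \<le> (A + N / 2) * (v - u) powr \<alpha>"
    if "0 \<le> N" and N: "\<And>u v. \<lbrakk>0 \<le> u; u \<le> v; v \<le> T; v - u \<le> \<Delta>\<rbrakk> \<Longrightarrow> norm (x v - x u) \<le> N * (v - u) powr \<alpha>"
      and uv: "0 \<le> u" "u \<le> v" "v \<le> T" "v - u \<le> \<Delta>" for N u v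
  proof (cases "u = v")
    case False
    define h where "h = v - u"
    have h: "0 < h" "h \<le> \<Delta>" using uv False by (auto simp: h_def)
    have 1: "h \<le> \<Delta> powr (1 - \<alpha>) * h powr \<alpha>"
    proof -
      have "h = h powr (1 - \<alpha>) * h powr \<alpha>" using h by (simp flip: powr_add)
      also have "\<dots> \<le> \<Delta> powr (1 - \<alpha>) * h powr \<alpha>"
        using h assms by (intro mult_right_mono powr_mono2) auto
      finally show ?thesis .
    qed
    have 2: "h powr \<beta> \<le> \<Delta> powr (\<beta> - \<alpha>) * h powr \<alpha>"
    proof -
      have "h powr \<beta> = h powr (\<beta> - \<alpha>) * h powr \<alpha>" using h by (simp flip: powr_add)
      also have "\<dots> \<le> \<Delta> powr (\<beta> - \<alpha>) * h powr \<alpha>"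
        using h assms by (intro mult_right_mono powr_mono2) auto
      finally show ?thesis .
    qed
    have 3: "K * (G * h powr \<beta>) \<le> 1 / 2"
    proof -
      have "2 * K * (G * h powr \<beta>) \<le> \<kappa> * (G * \<Delta> powr \<beta>)"
        using h assms \<open>\<beta> > 0\<close> by (intro mult_mono powr_mono2) (auto simp: \<kappa>_def)
      then show ?thesis using \<kappa>G by linarith
    qed
    have "norm (x v - x u) \<le> B * h + S * G * h powr \<beta> + K * (P + N) * G * h powr (\<alpha> + \<beta>)"
      unfolding h_def using uv \<open>0 \<le> N\<close> by (intro loc N) auto
    also have "K * (P + N) * G * h powr (\<alpha> + \<beta>) = (K * (G * h powr \<beta>)) * ((P + N) * h powr \<alpha>)"
      by (simp add: powr_add mult_ac)
    also have "B * h + S * G * h powr \<beta> + (K * (G * h powr \<beta>)) * ((P + N) * h powr \<alpha>)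
        \<le> B * (\<Delta> powr (1 - \<alpha>) * h powr \<alpha>) + S * G * (\<Delta> powr (\<beta> - \<alpha>) * h powr \<alpha>) + (1 / 2) * ((P + N) * h powr \<alpha>)"
      using 1 2 3 assms \<open>0 \<le> N\<close> by (intro add_mono mult_left_mono mult_right_mono) auto
    also have "\<dots> = (A + N / 2) * h powr \<alpha>"
      by (simp add: A_def algebra_simps add_divide_distrib)
    finally show ?thesis by (simp add: h_def)
  qed simp
  \<comment> \<open>\<open>2 * A\<close> is the fixed point of the improvement, and each round
    halves the excess over it. The finite \<open>N'\<close> starts the iteration and disappears in
    the limit.\<close>
  have iter: "norm (x v - x u) \<le> (2 * A + N' / 2 ^ n) * (v - u) powr \<alpha>"
    if "0 \<le> u" "u \<le> v" "v \<le> T" "v - u \<le> \<Delta>" for n u v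
    using that
  proof (induction n arbitrary: u v)
    case 0
    have "norm (x v - x u) \<le> N' * (v - u) powr \<alpha>" using glob 0 by blast
    also have "\<dots> \<le> (2 * A + N') * (v - u) powr \<alpha>"
      using \<open>A \<ge> 0\<close> by (intro mult_right_mono) auto
    finally show ?case by simp
  next
    case (Suc n)
    have "norm (x v - x u) \<le> (A + (2 * A + N' / 2 ^ n) / 2) * (v - u) powr \<alpha>"
      using Suc \<open>A \<ge> 0\<close> \<open>0 \<le> N'\<close> by (intro improve) auto
    then show ?case by (simp add: add_divide_distrib mult.commute)
  qed
  have small: "norm (x v - x u) \<le> 2 * A * (v - u) powr \<alpha>"
    if "0 \<le> u" "u \<le> v" "v \<le> T" "v - u \<le> \<Delta>" for u v
  proof (rule LIMSEQ_le_const)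
    have "(\<lambda>n. (2 * A + N' * (1 / 2) ^ n) * (v - u) powr \<alpha>) \<longlonglongrightarrow> (2 * A + N' * 0) * (v - u) powr \<alpha>"
      by (intro tendsto_intros LIMSEQ_power_zero) auto
    then show "(\<lambda>n. (2 * A + N' / 2 ^ n) * (v - u) powr \<alpha>) \<longlonglongrightarrow> 2 * A * (v - u) powr \<alpha>"
      by (simp add: power_divide)
  qed (use iter that in blast)
  \<comment> \<open>Bounds the increment over one cell of length \<open>\<Delta>\<close>
    independently of \<open>G\<close>, since
    \<open>G * \<Delta> powr \<beta> \<le> 1 / \<kappa>\<close>.\<close>
  have AM: "2 * A * \<Delta> powr \<alpha> \<le> M"
  proof -
    have "2 * A * \<Delta> powr \<alpha> = 2 * (B * (\<Delta> powr (1 - \<alpha>) * \<Delta> powr \<alpha>) + S * (G * (\<Delta> powr (\<beta> - \<alpha>) * \<Delta> powr \<alpha>))) + P * \<Delta> powr \<alpha>"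
      by (simp add: A_def algebra_simps)
    also have "\<dots> = 2 * (B * \<Delta> + S * (G * \<Delta> powr \<beta>)) + P * \<Delta> powr \<alpha>"
      using \<open>\<Delta> > 0\<close> by (simp flip: powr_add)
    also have "\<dots> \<le> 2 * (B * T + S * (1 / \<kappa>)) + P * T powr \<alpha>"
      using \<kappa>G \<open>\<kappa> > 0\<close> \<open>\<Delta> \<le> T\<close> \<open>\<Delta> > 0\<close> assms
      by (intro add_mono mult_left_mono powr_mono2) (auto simp: field_simps)
    finally show ?thesis by (simp add: M_def)
  qed
  have "M \<ge> 0" using assms \<open>\<kappa> > 0\<close> by (simp add: M_def)
  have inv\<Delta>: "1 / \<Delta> = R powr (1 / \<beta>)"
    using \<open>R > 0\<close> by (simp add: \<Delta>_def powr_minus_divide)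
  have "norm (x t - x s) \<le> 3 * M * T powr (1 - \<alpha>) * (1 / \<Delta>) * (t - s) powr \<alpha>"
  proof (cases "t - s \<le> \<Delta>")
    case True
    \<comment> \<open>This form makes \<open>AM\<close> applicable and exposes the factor
      \<open>1 / \<Delta>\<close> common to both cases.\<close>
    have "2 * A = 2 * A * \<Delta> powr \<alpha> * (\<Delta> powr (1 - \<alpha>) * (1 / \<Delta>))"
      using \<open>\<Delta> > 0\<close> by (simp add: powr_diff)
    also have "\<dots> \<le> M * (T powr (1 - \<alpha>) * (1 / \<Delta>))"
      using AM \<open>\<Delta> \<le> T\<close> \<open>\<Delta> > 0\<close> \<open>M \<ge> 0\<close> assms by (intro mult_mono powr_mono2) auto
    also have "\<dots> \<le> 3 * (M * (T powr (1 - \<alpha>) * (1 / \<Delta>)))"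
    proof -
      have "0 \<le> M * (T powr (1 - \<alpha>) * (1 / \<Delta>))"
        using \<open>M \<ge> 0\<close> \<open>\<Delta> > 0\<close> by simp
      then show ?thesis by linarith
    qed
    finally have "2 * A * (t - s) powr \<alpha> \<le> 3 * (M * (T powr (1 - \<alpha>) * (1 / \<Delta>))) * (t - s) powr \<alpha>"
      by (rule mult_right_mono) simp
    then show ?thesis using small[OF st True] by (simp add: mult_ac)
  next
    case False
    define h where "h = t - s"
    have h: "\<Delta> < h" "h \<le> T" using False st by (auto simp: h_def)
    have "norm (x t - x s) \<le> M * ((t - s) / \<Delta> + 2)"
    proof (rule norm_diff_le_of_cells)
      fix k u v
      assume uv: "s \<le> u" "u \<le> v" "v \<le> t" "real k * \<Delta> \<le> u" "v \<le> real (Suc k) * \<Delta>"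
      then have "v - u \<le> \<Delta>" by (simp add: algebra_simps)
      then have "norm (x v - x u) \<le> 2 * A * (v - u) powr \<alpha>" using uv st by (intro small) auto
      also have "\<dots> \<le> 2 * A * \<Delta> powr \<alpha>"
        using uv \<open>v - u \<le> \<Delta>\<close> \<open>A \<ge> 0\<close> assms by (intro mult_left_mono powr_mono2) auto
      finally show "norm (x v - x u) \<le> M" using AM by linarith
    qed (use st \<open>\<Delta> > 0\<close> \<open>M \<ge> 0\<close> in auto)
    also have "\<dots> \<le> M * (3 * (T powr (1 - \<alpha>) * h powr \<alpha> / \<Delta>))"
    proof (rule mult_left_mono[OF _ \<open>M \<ge> 0\<close>])
      \<comment> \<open>For \<open>h\<close> above \<open>\<Delta>\<close> the 2 surplus cells are
        absorbed into \<open>3 * (h / \<Delta>)\<close>.\<close>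
      have "1 \<le> h / \<Delta>" using h \<open>\<Delta> > 0\<close> by simp
      then have "(t - s) / \<Delta> + 2 \<le> 3 * (h / \<Delta>)" unfolding h_def by linarith
      also have "h = h powr (1 - \<alpha>) * h powr \<alpha>"
        using h \<open>\<Delta> > 0\<close> by (simp flip: powr_add)
      also have "3 * (h powr (1 - \<alpha>) * h powr \<alpha> / \<Delta>) \<le> 3 * (T powr (1 - \<alpha>) * h powr \<alpha> / \<Delta>)"
        using h \<open>\<Delta> > 0\<close> assms by (intro mult_left_mono divide_right_mono mult_right_mono powr_mono2) auto
      finally show "(t - s) / \<Delta> + 2 \<le> 3 * (T powr (1 - \<alpha>) * h powr \<alpha> / \<Delta>)" .
    qed
    finally show ?thesis by (simp add: h_def mult_ac)
  qed
  then show ?thesis unfolding inv\<Delta> R_def .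
qed

lemma powr_add_le:
  fixes a b p :: real
  assumes "0 \<le> a" "0 \<le> b" "0 \<le> p"
  shows "(a + b) powr p \<le> 2 powr p * (a powr p + b powr p)"
proof -
  have "(a + b) powr p \<le> (2 * max a b) powr p" using assms by (intro powr_mono2) auto
  also have "\<dots> = 2 powr p * max a b powr p" using assms by (simp add: powr_mult)
  also have "\<dots> \<le> 2 powr p * (a powr p + b powr p)" by (auto simp: max_def)
  finally show ?thesis .
qed

theorem theorem4p3:
  fixes T \<gamma> lam K0 \<nu> :: real
    and x0 :: "real^'d"
    and \<sigma> :: "real \<Rightarrow> real^'d \<Rightarrow> real^'m^'d"
    and b :: "real \<Rightarrow> real^'d \<Rightarrow> real^'d"
  assumes "T > 0"
    and "1/2 < \<gamma>" and "\<gamma> \<le> 1"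
    and "1/2 < lam" and "lam < \<gamma>"
    and "\<And>i. x0 $ i > 0"
    and "bounded ((\<lambda>(t, x). \<sigma> t x) ` ({0..T} \<times> UNIV))"
    and "bounded ((\<lambda>(t, x). b t x) ` ({0..T} \<times> UNIV))"
    and "K0 \<ge> 0" and "\<nu> \<ge> \<gamma>"
    and "\<And>t x y. t \<in> {0..T} \<Longrightarrow> norm (\<sigma> t x - \<sigma> t y) \<le> K0 * norm (x - y)"
    and "\<And>s t x. s \<in> {0..T} \<Longrightarrow> t \<in> {0..T} \<Longrightarrow> norm (\<sigma> t x - \<sigma> s x) \<le> K0 * \<bar>t - s\<bar> powr \<nu>"
    and "\<And>t x y. t \<in> {0..T} \<Longrightarrow> norm (b t x - b t y) \<le> K0 * norm (x - y)"
  shows "\<exists>M2>0. \<exists>M3>0. \<forall>g \<in> hoelder_space \<gamma> T. \<forall>x \<in> hoelder_space lam T.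
           is_reflected_solution T b \<sigma> g x0 x \<longrightarrow>
           hoelder_seminorm lam T x \<le> M2 + M3 * hoelder_seminorm \<gamma> T g powr (1 / \<gamma>)"
proof -
  note \<sigma>_x = assms(11) and \<sigma>_t = assms(12)
  obtain S where "S > 0" and bound_S: "\<And>y. y \<in> (\<lambda>(t, x). \<sigma> t x) ` ({0..T} \<times> UNIV) \<Longrightarrow> norm y \<le> S"
    using assms(7) unfolding bounded_pos by blast
  have S: "S \<ge> 0" "\<And>t x. t \<in> {0..T} \<Longrightarrow> norm (\<sigma> t x) \<le> S"
    using \<open>S > 0\<close> by (auto intro!: bound_S)
  obtain B where "B > 0" and bound_B: "\<And>y. y \<in> (\<lambda>(t, x). b t x) ` ({0..T} \<times> UNIV) \<Longrightarrow> norm y \<le> B"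
    using assms(8) unfolding bounded_pos by blast
  have B: "B \<ge> 0" "\<And>t x. t \<in> {0..T} \<Longrightarrow> norm (b t x) \<le> B"
    using \<open>B > 0\<close> by (auto intro!: bound_B)
  define c where "c = 1 + real CARD('d)"
  define C where "C = young_const (lam + \<gamma>)"
  have pos: "0 \<le> c" "0 \<le> C" using assms young_const_nonneg[of "lam + \<gamma>"] by (auto simp: c_def C_def)
  \<comment> \<open>Converts time regularity of order \<open>\<nu>\<close> into order
    \<open>lam\<close> on \<open>[0,T]\<close>, as \<open>\<nu> > lam\<close>.\<close>
  define P where "P = T powr (\<nu> - lam)"
  define \<kappa> where "\<kappa> = 2 * (c * C * K0) + 1"
  have "\<kappa> > 0" using pos assms by (simp add: \<kappa>_def add_nonneg_pos)
  \<comment> \<open>The constant of \<open>a_priori_bound\<close> for \<open>K = c * C * K0\<close>,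
    with \<open>c * B\<close> and \<open>c * S\<close> in place of \<open>B\<close> and
    \<open>S\<close>. The last factor pays for splitting a power of a sum by
    \<open>powr_add_le\<close>. All this is fixed before \<open>g\<close> and
    \<open>x\<close>.\<close>
  define M where "M = 3 * (2 * (c * B * T + c * S / \<kappa>) + P * T powr lam) * T powr (1 - lam) * 2 powr (1 / \<gamma>)"
  \<comment> \<open>Strict positivity comes from the summand \<open>P * T powr lam\<close>.\<close>
  have "M > 0"
    using assms pos S B \<open>\<kappa> > 0\<close> by (auto simp: M_def P_def intro!: mult_pos_pos add_nonneg_pos)
  define M2 where "M2 = M * (T powr - \<gamma>) powr (1 / \<gamma>)"
  define M3 where "M3 = M * \<kappa> powr (1 / \<gamma>)"
  have "hoelder_seminorm lam T x \<le> M2 + M3 * hoelder_seminorm \<gamma> T g powr (1 / \<gamma>)"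
    if g: "g \<in> hoelder_space \<gamma> T" and x: "x \<in> hoelder_space lam T"
      and sol: "is_reflected_solution T b \<sigma> g x0 x" for g x
  proof (rule hoelder_seminorm_le[OF \<open>T > 0\<close>])
    define G where "G = hoelder_seminorm \<gamma> T g"
    have G: "G \<ge> 0" using g \<open>T > 0\<close> by (simp add: G_def hoelder_seminorm_nonneg)
    define N0 where "N0 = hoelder_seminorm lam T x"
    have N0: "N0 \<ge> 0" using x \<open>T > 0\<close> by (simp add: N0_def hoelder_seminorm_nonneg)
    have glob: "norm (x v - x u) \<le> N0 * (v - u) powr lam" if "0 \<le> u" "u \<le> v" "v \<le> T" for u v
      using hoelder_seminorm_bound[OF x that] by (simp add: N0_def)
    \<comment> \<open>Only the increment of \<open>x\<close> over this one pair of times is assumed,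
      so the bound serves both the global constant \<open>N0\<close> and a local
      \<open>N\<close>.\<close>
    have \<sigma>_inc: "norm (\<sigma> v (x v) - \<sigma> u (x u)) \<le> K0 * (P + N) * (v - u) powr lam"
      if uv: "0 \<le> u" "u \<le> v" "v \<le> T" and N: "norm (x v - x u) \<le> N * (v - u) powr lam" for u v N
    proof -
      have "(v - u) powr \<nu> = (v - u) powr (\<nu> - lam) * (v - u) powr lam"
        using uv by (simp flip: powr_add)
      also have "\<dots> \<le> P * (v - u) powr lam"
        unfolding P_def using uv assms by (intro mult_right_mono powr_mono2) auto
      finally have "norm (\<sigma> v (x u) - \<sigma> u (x u)) \<le> K0 * (P * (v - u) powr lam)"
        using \<sigma>_t[of u v "x u"] uv \<open>K0 \<ge> 0\<close> by (auto elim!: order_trans intro!: mult_left_mono)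
      moreover have "norm (\<sigma> v (x v) - \<sigma> v (x u)) \<le> K0 * (N * (v - u) powr lam)"
        using \<sigma>_x[of v "x v" "x u"] uv N \<open>K0 \<ge> 0\<close> by (auto elim!: order_trans intro!: mult_left_mono)
      moreover have "\<sigma> v (x v) - \<sigma> u (x u) = (\<sigma> v (x v) - \<sigma> v (x u)) + (\<sigma> v (x u) - \<sigma> u (x u))"
        by simp
      ultimately have "norm (\<sigma> v (x v) - \<sigma> u (x u)) \<le> K0 * (N * (v - u) powr lam) + K0 * (P * (v - u) powr lam)"
        by (metis norm_triangle_mono)
      then show ?thesis by (simp add: algebra_simps)
    qed
    fix u v
    assume uv: "0 \<le> u" "u \<le> v" "v \<le> T"
    have "norm (x v - x u) \<le> 3 * (2 * (c * B * T + c * S / (2 * (c * C * K0) + 1)) + P * T powr lam)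
        * T powr (1 - lam) * (T powr (- \<gamma>) + (2 * (c * C * K0) + 1) * G) powr (1 / \<gamma>) * (v - u) powr lam"
    proof (rule a_priori_bound[where N' = N0])
      fix N s t
      assume N: "0 \<le> N" and st: "0 \<le> s" "s \<le> t" "t \<le> T"
        and loc: "\<And>u v. \<lbrakk>s \<le> u; u \<le> v; v \<le> t\<rbrakk> \<Longrightarrow> norm (x v - x u) \<le> N * (v - u) powr lam"
      have "norm (x t - x s) \<le> c *
          (B * (t - s) + S * G * (t - s) powr \<gamma> + C * (K0 * (P + N) * G * (t - s) powr (lam + \<gamma>)))"
        unfolding c_def C_def
      proof (rule reflected_increment[OF \<open>T > 0\<close> assms(6) sol])
        show "norm (\<sigma> v (x v) - \<sigma> u (x u)) \<le> K0 * (P + N0) * (v - u) powr lam"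
          if "0 \<le> u" "u \<le> v" "v \<le> T" for u v
          using that by (intro \<sigma>_inc glob) auto
        show "norm (\<sigma> v (x v) - \<sigma> u (x u)) \<le> K0 * (P + N) * (v - u) powr lam"
          if "s \<le> u" "u \<le> v" "v \<le> t" for u v
          using that st by (intro \<sigma>_inc loc) auto
        show "norm (g v - g u) \<le> G * (v - u) powr \<gamma>" if "0 \<le> u" "u \<le> v" "v \<le> T" for u v
          using hoelder_seminorm_bound[OF g that] by (simp add: G_def)
      qed (use assms S B G N N0 st in \<open>auto simp: P_def\<close>)
      then show "norm (x t - x s) \<le> c * B * (t - s) + c * S * G * (t - s) powr \<gamma>
          + c * C * K0 * (P + N) * G * (t - s) powr (lam + \<gamma>)"
        by (simp add: algebra_simps)
    qed (use assms S B G N0 pos glob uv in \<open>auto simp: P_def\<close>)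
    also have "\<dots> = M / 2 powr (1 / \<gamma>) * (T powr (- \<gamma>) + \<kappa> * G) powr (1 / \<gamma>) * (v - u) powr lam"
      by (simp add: M_def \<kappa>_def)
    also have "\<dots> \<le> M / 2 powr (1 / \<gamma>) *
        (2 powr (1 / \<gamma>) * ((T powr (- \<gamma>)) powr (1 / \<gamma>) + (\<kappa> * G) powr (1 / \<gamma>))) * (v - u) powr lam"
      using \<open>M > 0\<close> \<open>\<kappa> > 0\<close> G assms by (intro mult_right_mono mult_left_mono powr_add_le) auto
    also have "\<dots> = (M2 + M3 * G powr (1 / \<gamma>)) * (v - u) powr lam"
      using \<open>\<kappa> > 0\<close> G by (simp add: M2_def M3_def powr_mult algebra_simps)
    finally show "norm (x v - x u) \<le> (M2 + M3 * hoelder_seminorm \<gamma> T g powr (1 / \<gamma>)) * (v - u) powr lam"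
      by (simp add: G_def)
  qed
  moreover have "M2 > 0" "M3 > 0"
    using \<open>M > 0\<close> \<open>\<kappa> > 0\<close> \<open>T > 0\<close> by (auto simp: M2_def M3_def)
  ultimately show ?thesis by blast
qed

end
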